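(* Let $m\ge 2$, let $f(x)=1-2|x-1/2|$, $x\in[0,1]$, be the standard tent map, and let $A$ be a real $m\times m$ symmetric matrix satisfying $A\mathbf{e}=0$, where $\mathbf{e}=[1,\dots,1]^\top$. Consider the coupled map lattice $$T:\quad \mathbf{x}(n+1)=(I+cA)\,\mathbf{f}(\mathbf{x}(n)),\qquad \mathbf{f}(\mathbf{x})=[f(x_1),\dots,f(x_m)]^\top.$$ There exists $c_+>0$ such that if the coupling coefficient satisfies $0\le c<c_+$ (and $I+cA$ maps $[0,1]^m$ into itself, so that $T$ is a self-map of $[0,1]^m$), then there exists a constant $\gamma_0>0$ such that for Lebesgue almost every initial point $\mathbf{x}(0)\in[0,1]^m$, $$\liminf_{n\to\infty}\mathrm{dist}(\mathbf{x}(n),D_{\mathrm{syn}})=0\quad\text{and}\quad \limsup_{n\to\infty}\mathrm{dist}(\mathbf{x}(n),D_{\mathrm{syn}})\ge\gamma_0.$$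
   Context: $I$ is the $m\times m$ identity matrix, $D_{\mathrm{syn}}=\{(x_1,\dots,x_m)\in[0,1]^m: x_1=\cdots=x_m\}$, and $\mathrm{dist}$ is the Euclidean distance from a point to a set. *)

theory Defs
  imports "HOL-Analysis.Analysis"
begin

definition tent :: "real \<Rightarrow> real" where
  "tent x = 1 - 2 * \<bar>x - 1/2\<bar>"

definition unit_cube :: "(real ^ 'm) set" where
  "unit_cube = {x. \<forall>i. 0 \<le> x $ i \<and> x $ i \<le> 1}"

definition D_syn :: "(real ^ 'm) set" where
  "D_syn = {x \<in> unit_cube. \<forall>i j. x $ i = x $ j}"

definition tent_vec :: "real ^ 'm \<Rightarrow> real ^ 'm" where
  "tent_vec x = (\<chi> i. tent (x $ i))"

definition coupling :: "real \<Rightarrow> real ^ 'm ^ 'm \<Rightarrow> real ^ 'm ^ 'm" where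
  "coupling c A = mat 1 + c *\<^sub>R A"

definition cml :: "real \<Rightarrow> real ^ 'm ^ 'm \<Rightarrow> real ^ 'm \<Rightarrow> real ^ 'm" where
  "cml c A x = coupling c A *v tent_vec x"

end

theory Submission
  imports Defs
begin

text \<open>
  Write \<open>T\<close> for the coupled map. For small \<open>c\<close> it is piecewise affine with one piece per dyadic
  subcube, expands all distances inside a piece by at least \<open>3/2\<close>, and moves each coordinate nearly
  like the tent map. A coordinate close to the critical value \<open>1/2\<close> is sent close to \<open>1\<close>, then
  close to \<open>0\<close>, and needs about \<open>K\<close> steps to come back; so a small open set is cut by at most \<open>m\<close>
  coordinate hyperplanes during \<open>K\<close> steps, while its size grows by \<open>(3/2)^K\<close>. Each cut only multiplies
  the volume of an \<open>e\<close>-neighbourhood of the boundary by a bounded factor. Hence the total volume of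
  the parts of the image pieces that are \<open>e\<close>-close to the boundary of their piece eventually is at
  most a small fraction of the whole, for some \<open>e\<close> that does not depend on \<open>c\<close>: most of the mass lies
  in pieces containing a ball of radius \<open>e\<close>.

  Consequently a closed forward invariant set \<open>E\<close> is null as soon as every ball of radius \<open>e\<close> meets
  the complement of \<open>E\<close> in volume at least some \<open>\<kappa> > 0\<close>. This is applied to the set of points whose
  whole orbit stays \<open>r\<close>-far from the diagonal (every ball of radius \<open>e\<close> contains a point that is mapped
  into the diagonal, by closeness to the uncoupled map and Brouwer's theorem) and to the set of points
  whose whole orbit stays \<open>e/32\<close>-close to it.
\<close>

section \<open>Volumes of boundary layers\<close>

lemma abs_component_diff_le: "\<bar>x $ i - y $ i\<bar> \<le> dist x (y::real^'m)"
  using component_le_norm_cart[of "x - y" i] by (simp add: dist_norm)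

lemma dist_le_of_components:
  fixes x y :: "real^'m"
  assumes "\<And>i. \<bar>x $ i - y $ i\<bar> \<le> r"
  shows "dist x y \<le> real CARD('m) * r"
proof -
  have "dist x y \<le> (\<Sum>i\<in>UNIV. \<bar>(x - y) $ i\<bar>)" unfolding dist_norm by (rule norm_le_l1_cart)
  also have "\<dots> \<le> (\<Sum>i\<in>(UNIV::'m set). r)" using assms by (intro sum_mono) auto
  finally show ?thesis by simp
qed

abbreviation vol :: "'a::euclidean_space set \<Rightarrow> real" where
  "vol \<equiv> measure lebesgue"

lemma vol_mono:
  assumes "A \<subseteq> B" "A \<in> lmeasurable" "B \<in> lmeasurable"
  shows "vol A \<le> vol B"
  using assms by (intro measure_mono_fmeasurable) auto

lemma lmeasurable_Int_open:
  assumes "A \<in> lmeasurable" "open U"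
  shows "A \<inter> U \<in> lmeasurable"
proof (rule fmeasurableI2[OF assms(1)])
  show "A \<inter> U \<in> sets lebesgue"
    using assms by (intro sets.Int) auto
qed simp

lemma sum_vol_disjoint_le:
  assumes "finite I" "X \<in> lmeasurable" "\<And>i. i \<in> I \<Longrightarrow> open (R i)"
    and "disjoint_family_on R I"
  shows "(\<Sum>i\<in>I. vol (X \<inter> R i)) \<le> vol X"
proof -
  have m: "X \<inter> R i \<in> lmeasurable" if "i \<in> I" for i
    using assms that by (intro lmeasurable_Int_open) auto
  have "(\<Sum>i\<in>I. vol (X \<inter> R i)) = vol (\<Union>i\<in>I. X \<inter> R i)"
    using assms(1,4) m
    by (intro measure_UNION'[symmetric]) (auto simp: pairwise_def disjnt_def disjoint_family_on_def)
  also have "\<dots> \<le> vol X"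
    using assms m by (intro vol_mono fmeasurable.finite_UN) auto
  finally show ?thesis .
qed

lemma sum_vol_partition:
  assumes "finite I" "X \<in> lmeasurable" "\<And>i. i \<in> I \<Longrightarrow> open (R i)"
    and "disjoint_family_on R I" "negligible (X - (\<Union>i\<in>I. R i))"
  shows "vol X = (\<Sum>i\<in>I. vol (X \<inter> R i))"
proof -
  have m: "X \<inter> R i \<in> lmeasurable" if "i \<in> I" for i
    using assms that by (intro lmeasurable_Int_open) auto
  have "(\<Sum>i\<in>I. vol (X \<inter> R i)) = vol (\<Union>i\<in>I. X \<inter> R i)"
    using assms(1,4) m
    by (intro measure_UNION'[symmetric]) (auto simp: pairwise_def disjnt_def disjoint_family_on_def)
  also have "\<dots> = vol X"
    using assms by (intro measure_negligible_symdiff) (auto elim: negligible_subset)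
  finally show ?thesis by simp
qed

text \<open>A one-sided collar: the ball of radius \<open>e\<close> about a point of
  \<open>W\<close> fits into \<open>W\<close> exactly when the point lies outside this set.\<close>

definition inner_bd :: "real \<Rightarrow> 'a::metric_space set \<Rightarrow> 'a set" where
  "inner_bd e W = {x \<in> W. \<exists>y. y \<notin> W \<and> dist x y < e}"

lemma inner_bd_subset: "inner_bd e W \<subseteq> W"
  by (auto simp: inner_bd_def)

lemma inner_bd_mono: "e \<le> e' \<Longrightarrow> inner_bd e W \<subseteq> inner_bd e' W"
  by (force simp: inner_bd_def)

lemma open_inner_bd:
  assumes "open W"
  shows "open (inner_bd e W)"
proof -
  have "inner_bd e W = W \<inter> (\<Union>y\<in>-W. ball y e)"
    by (auto simp: inner_bd_def dist_commute)
  with assms show ?thesis by auto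
qed

lemma unit_cube_eq_cbox: "unit_cube = cbox (0::real^'m) (\<chi> i. 1)"
  by (auto simp: unit_cube_def mem_box_cart)

lemma lmeasurable_open_subset_cube:
  fixes W :: "(real^'m) set"
  assumes "open W" "W \<subseteq> unit_cube"
  shows "W \<in> lmeasurable"
  by (rule lmeasurable_open[OF bounded_subset[OF bounded_cbox]])
    (use assms in \<open>auto simp: unit_cube_eq_cbox\<close>)

lemma lmeasurable_inner_bd:
  fixes W :: "(real^'m) set"
  assumes "open W" "W \<subseteq> unit_cube"
  shows "inner_bd e W \<in> lmeasurable"
  by (rule lmeasurable_open_subset_cube)
    (use assms in \<open>auto simp: inner_bd_def intro: open_inner_bd[unfolded inner_bd_def]\<close>)

lemma open_coord_strip: "open {x::real^'m. a < x $ i \<and> x $ i < b}"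
  by (intro open_Collect_conj open_Collect_less continuous_intros)

lemma open_slab: "open {x::real^'m. \<bar>x $ i - c\<bar> < e}"
  by (intro open_Collect_less continuous_intros)

text \<open>Slide the slab along the \<open>i\<close>-th axis by multiples of its width: each point
  stays in \<open>W\<close> until it is close to the complement, and the slid slabs are disjoint.\<close>

lemma vol_slab_le:
  fixes W :: "(real^'m) set"
  assumes W: "open W" "W \<subseteq> unit_cube" and e: "e > 0"
  shows "vol (W \<inter> {x. \<bar>x $ i - c\<bar> < e}) \<le> vol (inner_bd (3*e) W)"
proof -
  define R where "R = (\<lambda>j::nat. {x::real^'m. \<bar>x $ i - (c + 2*e*real j)\<bar> < e})"
  have oR: "open (R j)" for j unfolding R_def by (rule open_slab)
  define v :: "real^'m" where "v = (2*e) *\<^sub>R axis i 1"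
  have bm: "inner_bd (3*e) W \<in> lmeasurable" using W by (rule lmeasurable_inner_bd)
  have step: "vol (W \<inter> R j) \<le> vol (W \<inter> R (Suc j)) + vol (inner_bd (3*e) W \<inter> R j)" for j
  proof -
    define U where "U = W \<inter> R j \<inter> {x. v + x \<in> W}"
    have "{x. v + x \<in> W} = (+) (-v) ` W"
      by (auto simp: image_iff algebra_simps intro!: bexI[of _ "v + _"])
    then have oU: "open U"
      unfolding U_def using W oR by (metis open_Int open_translation)
    have mU: "U \<in> lmeasurable"
      using oU W by (intro lmeasurable_open_subset_cube) (auto simp: U_def)
    have "(+) v ` U \<subseteq> W \<inter> R (Suc j)"
      by (auto simp: U_def R_def v_def algebra_simps)
    then have "vol U \<le> vol (W \<inter> R (Suc j))"
      using mU W oR vol_mono[of "(+) v ` U" "W \<inter> R (Suc j)"]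
      by (simp add: measure_translation measurable_translation lmeasurable_Int_open lmeasurable_open_subset_cube)
    moreover have "W \<inter> R j \<subseteq> U \<union> (inner_bd (3*e) W \<inter> R j)"
    proof
      fix x assume x: "x \<in> W \<inter> R j"
      show "x \<in> U \<union> (inner_bd (3*e) W \<inter> R j)"
      proof (cases "v + x \<in> W")
        case True then show ?thesis using x by (auto simp: U_def)
      next
        case False
        have "dist x (v + x) = 2*e" using e by (simp add: dist_norm v_def)
        then have "x \<in> inner_bd (3*e) W" using False x e unfolding inner_bd_def by force
        then show ?thesis using x by auto
      qed
    qed
    then have "vol (W \<inter> R j) \<le> vol (U \<union> (inner_bd (3*e) W \<inter> R j))"
      using mU lmeasurable_Int_open[OF bm oR] lmeasurable_Int_open[OF lmeasurable_open_subset_cube[OF W] oR]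
      by (intro vol_mono fmeasurable.Un)
    moreover have "vol (U \<union> (inner_bd (3*e) W \<inter> R j)) \<le> vol U + vol (inner_bd (3*e) W \<inter> R j)"
      using mU lmeasurable_Int_open[OF bm oR] by (intro measure_Un_le) auto
    ultimately show ?thesis by linarith
  qed
  have sum: "vol (W \<inter> R 0) \<le> vol (W \<inter> R n) + (\<Sum>j<n. vol (inner_bd (3*e) W \<inter> R j))" for n
  proof (induction n)
    case (Suc n)
    then show ?case using step[of n] by simp
  qed simp
  obtain n where n: "(2 + \<bar>c\<bar> + e) / (2*e) < real n" using reals_Archimedean2 by blast
  then have n': "2 + \<bar>c\<bar> + e < 2*e*real n" using e by (simp add: field_simps)
  have "W \<inter> R n = {}"
  proof (intro equals0I)
    fix x assume x: "x \<in> W \<inter> R n"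
    then have "x $ i \<le> 1" using W by (auto simp: unit_cube_def)
    with x n' show False by (auto simp: R_def)
  qed
  have "disjoint_family_on R {..<n}"
  proof -
    have "R j \<inter> R k = {}" if "j < k" for j k
    proof -
      have "2*e*real j + 2*e \<le> 2*e*real k"
        using that e mult_left_mono[of "real j + 1" "real k" "2*e"] by (simp add: algebra_simps)
      then show ?thesis by (auto simp: R_def)
    qed
    then show ?thesis unfolding disjoint_family_on_def by (metis Int_commute nat_neq_iff)
  qed
  then have "(\<Sum>j<n. vol (inner_bd (3*e) W \<inter> R j)) \<le> vol (inner_bd (3*e) W)"
    using bm oR by (intro sum_vol_disjoint_le) auto
  moreover have "R 0 = {x. \<bar>x $ i - c\<bar> < e}" by (simp add: R_def)
  ultimately show ?thesis using sum[of n] \<open>W \<inter> R n = {}\<close> by simp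
qed

text \<open>Among about \<open>w / (2 * e)\<close> disjoint translates of the grid, one meets \<open>W\<close> in a small set.\<close>

lemma grid_offset_exists:
  fixes W :: "(real^'m) set"
  assumes W: "W \<in> lmeasurable" and e: "e > 0" and w: "w > 0"
  obtains s where "0 \<le> s" "s < w"
    "vol (W \<inter> {x. \<exists>l::int. \<bar>x $ i - (s + of_int l * w)\<bar> < e}) \<le> 4 / w * e * vol W"
proof -
  define R where "R = (\<lambda>j::nat. {x::real^'m. \<exists>l::int. \<bar>x $ i - (2*e*real j + of_int l * w)\<bar> < e})"
  have oR: "open (R j)" for j
  proof -
    have "R j = (\<Union>l::int. {x. \<bar>x $ i - (2*e*real j + of_int l * w)\<bar> < e})"
      by (auto simp: R_def)
    then show ?thesis by (simp add: open_UN open_slab)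
  qed
  have mR: "W \<inter> R j \<in> lmeasurable" for j using W oR by (rule lmeasurable_Int_open)
  show thesis
  proof (cases "2*e \<le> w")
    case False
    \<comment> \<open>Here \<open>4 / w * e\<close> exceeds 2, so the offset 0 satisfies the bound
      trivially.\<close>
    have "vol (W \<inter> R 0) \<le> 1 * vol W" using mR W by (auto intro: vol_mono)
    also have "\<dots> \<le> 4 / w * e * vol W"
      using False w by (intro mult_right_mono) (auto simp: field_simps)
    finally show ?thesis using that[of 0] w by (simp add: R_def)
  next
    case True
    \<comment> \<open>\<open>J\<close> counts the slabs of width \<open>2 * e\<close> that fit into
      one period. As \<open>J\<close> is at least 1, rounding down loses at most a factor 2, which
      explains the constant 4.\<close>
    define J where "J = nat \<lfloor>w / (2*e)\<rfloor>"
    have J1: "real J \<ge> 1" and Jle: "2*e*real J \<le> w" and Jge: "real J \<ge> w / (4*e)"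
    proof -
      have a: "1 \<le> w / (2*e)" using True e by (simp add: field_simps)
      then have b: "1 \<le> \<lfloor>w / (2*e)\<rfloor>" by linarith
      then have c: "real J = of_int \<lfloor>w / (2*e)\<rfloor>" by (simp add: J_def)
      show "real J \<ge> 1" using b c by simp
      have "real J \<le> w / (2*e)" unfolding c by simp
      then show "2*e*real J \<le> w" using e by (simp add: field_simps)
      have "w / (2*e) < real J + 1" unfolding c by linarith
      with \<open>real J \<ge> 1\<close> have "w / (2*e) \<le> 2 * real J" by linarith
      then show "real J \<ge> w / (4*e)" using e by (simp add: field_simps)
    qed
    have disj: "disjoint_family_on R {..<J}"
    proof -
      have "R j \<inter> R k = {}" if jk: "j < k" "k < J" for j k
      proof -
        have 1: "2*e*real j + 2*e \<le> 2*e*real k"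
          using jk e mult_left_mono[of "real j + 1" "real k" "2*e"] by (simp add: algebra_simps)
        have 2: "2*e*real k + 2*e \<le> w"
          using jk e Jle mult_left_mono[of "real k + 1" "real J" "2*e"] by (simp add: algebra_simps)
        have 3: "0 \<le> 2*e*real j" using e by simp
        have False if "\<bar>y - (2*e*real j + of_int l * w)\<bar> < e" "\<bar>y - (2*e*real k + of_int l' * w)\<bar> < e"
          for y l l'
        proof (cases l l' rule: linorder_cases)
          case equal then show ?thesis using that 1 by auto
        next
          case less
          then have "of_int l * w + w \<le> of_int l' * w"
            using w mult_right_mono[of "of_int l + 1" "of_int l'" w] by (simp add: algebra_simps)
          then show ?thesis using that 1 2 3 by linarith
        next
          case greater
          then have "of_int l' * w + w \<le> of_int l * w"
            using w mult_right_mono[of "of_int l' + 1" "of_int l" w] by (simp add: algebra_simps)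
          then show ?thesis using that 1 2 3 by linarith
        qed
        then show ?thesis by (auto simp: R_def)
      qed
      then show ?thesis unfolding disjoint_family_on_def by (metis Int_commute lessThan_iff nat_neq_iff)
    qed
    have "\<exists>j<J. vol (W \<inter> R j) \<le> vol W / real J"
    proof (rule ccontr)
      assume "\<not> ?thesis"
      then have "vol W / real J < vol (W \<inter> R j)" if "j < J" for j using that by auto
      then have "(\<Sum>j<J. vol W / real J) < (\<Sum>j<J. vol (W \<inter> R j))"
        using J1 by (intro sum_strict_mono) (auto simp: lessThan_empty_iff bot_nat_def)
      moreover have "(\<Sum>j<J. vol (W \<inter> R j)) \<le> vol W"
        using W oR disj by (intro sum_vol_disjoint_le) auto
      ultimately show False using J1 by simp
    qed
    then obtain j where j: "j < J" "vol (W \<inter> R j) \<le> vol W / real J" by blast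
    have "vol W / real J \<le> 4 / w * e * vol W"
    proof -
      have "1 / real J \<le> 4 * e / w"
        using Jge J1 w e by (simp add: field_simps)
      then have "1 / real J * vol W \<le> 4 * e / w * vol W" by (intro mult_right_mono) auto
      then show ?thesis by simp
    qed
    with j(2) have j2: "vol (W \<inter> R j) \<le> 4 / w * e * vol W" by linarith
    have "2*e*real j < 2*e*real J" using j(1) e by simp
    then have "2*e*real j < w" using Jle by linarith
    then show ?thesis
      using that[of "2*e*real j"] j2 e by (simp add: R_def)
  qed
qed

section \<open>Cutting along the hyperplanes where a coordinate equals 1/2\<close>

text \<open>The index \<open>t\<close> lists the coordinates in the decreasing half of the tent map.
  Strict inequalities keep the cells open and disjoint, at the cost of a null set.\<close>

definition cell :: "'m set \<Rightarrow> (real^'m) set" where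
  "cell t = {x. \<forall>i. if i \<in> t then x $ i > 1/2 else x $ i < 1/2}"

lemma open_cell: "open (cell t :: (real^'m) set)"
proof -
  have "cell t = (\<Inter>i. if i \<in> t then {x::real^'m. x $ i > 1/2} else {x. x $ i < 1/2})"
    by (auto simp: cell_def split: if_splits)
  moreover have "open (if i \<in> t then {x::real^'m. x $ i > 1/2} else {x. x $ i < 1/2})" for i
    by (auto intro!: open_Collect_less continuous_intros)
  ultimately show ?thesis by (metis (no_types, lifting) finite open_INT)
qed

lemma cell_cases:
  "x \<in> cell t \<Longrightarrow> i \<in> t \<and> x $ i > 1/2 \<or> i \<notin> t \<and> x $ i < 1/2"
  unfolding cell_def by (metis (mono_tags, lifting) mem_Collect_eq)

lemma disjoint_cell: "disjoint_family_on (cell :: _ \<Rightarrow> (real^'m) set) I"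
proof -
  have "s = t" if "x \<in> cell s" "x \<in> cell t" for s t and x :: "real^'m"
  proof (intro set_eqI)
    fix i show "i \<in> s \<longleftrightarrow> i \<in> t"
      using that by (auto simp: cell_def dest!: spec[of _ i] split: if_splits)
  qed
  then show ?thesis by (auto simp: disjoint_family_on_def)
qed

lemma negligible_coord_eq: "negligible {x::real^'m. x $ i = c}"
  using negligible_standard_hyperplane[of "axis i 1 :: real^'m" c]
  by (simp add: cart_eq_inner_axis)

lemma negligible_outside_cells: "negligible (X - (\<Union>t. cell t) :: (real^'m) set)"
proof (rule negligible_subset)
  show "negligible (\<Union>i. {x::real^'m. x $ i = 1/2})"
    by (rule negligible_Union) (simp, use negligible_coord_eq in blast)
  show "X - (\<Union>t. cell t) \<subseteq> (\<Union>i. {x::real^'m. x $ i = 1/2})"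
  proof
    fix x assume x: "x \<in> X - (\<Union>t. cell t)"
    then have "x \<notin> cell {i. x $ i > 1/2}" by auto
    then show "x \<in> (\<Union>i. {x. x $ i = 1/2})" by (auto simp: cell_def split: if_splits)
  qed
qed

lemma vol_eq_sum_cells:
  fixes X :: "(real^'m) set"
  assumes "X \<in> lmeasurable"
  shows "vol X = (\<Sum>t\<in>UNIV. vol (X \<inter> cell t))"
  using assms by (intro sum_vol_partition open_cell disjoint_cell negligible_outside_cells finite)

text \<open>A nearby point outside the piece has either left \<open>W\<close> or crossed one of the
  hyperplanes that bound the cell.\<close>

lemma inner_bd_cell:
  fixes W :: "(real^'m) set"
  shows "inner_bd e (W \<inter> cell t) \<subseteq> (inner_bd e W \<union> (\<Union>i. W \<inter> {x. \<bar>x $ i - 1/2\<bar> < e})) \<inter> cell t"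
proof
  fix x assume "x \<in> inner_bd e (W \<inter> cell t)"
  then obtain y where x: "x \<in> W" "x \<in> cell t" and y: "y \<notin> W \<inter> cell t" "dist x y < e"
    by (auto simp: inner_bd_def)
  show "x \<in> (inner_bd e W \<union> (\<Union>i. W \<inter> {x. \<bar>x $ i - 1/2\<bar> < e})) \<inter> cell t"
  proof (cases "y \<in> W")
    case False then show ?thesis using x y by (auto simp: inner_bd_def)
  next
    case True
    with y have "y \<notin> cell t" by auto
    then obtain i where i: "\<not> (if i \<in> t then y $ i > 1/2 else y $ i < 1/2)" by (auto simp: cell_def)
    have "\<bar>x $ i - y $ i\<bar> < e"
      using y(2) abs_component_diff_le[of x i y] by linarith
    then have "\<bar>x $ i - 1/2\<bar> < e" using i cell_cases[OF x(2), of i] by (auto split: if_splits)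
    then show ?thesis using x by auto
  qed
qed

text \<open>The price of a cut: the old collar plus one slab per coordinate, each slab being
  absorbed by the collar of triple width through \<open>vol_slab_le\<close>.\<close>

lemma sum_inner_bd_cells_le:
  fixes W :: "(real^'m) set"
  assumes W: "open W" "W \<subseteq> unit_cube" and e: "e > 0"
  shows "(\<Sum>t\<in>UNIV. vol (inner_bd e (W \<inter> cell t))) \<le> (1 + real CARD('m)) * vol (inner_bd (3*e) W)"
proof -
  define S where "S = (\<lambda>i. W \<inter> {x. \<bar>x $ i - 1/2\<bar> < e})"
  define B where "B = inner_bd e W \<union> (\<Union>i. S i)"
  have oS: "open (S i)" "S i \<subseteq> unit_cube" for i
    unfolding S_def using W open_slab by (blast intro: open_Int)+
  then have mS: "S i \<in> lmeasurable" for i by (intro lmeasurable_open_subset_cube)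
  have mI: "inner_bd e W \<in> lmeasurable" for e using W by (rule lmeasurable_inner_bd)
  have mB: "B \<in> lmeasurable"
    using mS mI unfolding B_def by (intro fmeasurable.Un fmeasurable.finite_UN) auto
  have "(\<Sum>t\<in>UNIV. vol (inner_bd e (W \<inter> cell t))) \<le> (\<Sum>t\<in>UNIV. vol (B \<inter> cell t))"
  proof (intro sum_mono vol_mono)
    fix t :: "'m set"
    show "inner_bd e (W \<inter> cell t) \<subseteq> B \<inter> cell t"
      using inner_bd_cell by (simp add: B_def S_def)
    show "inner_bd e (W \<inter> cell t) \<in> lmeasurable"
      using W open_cell by (intro lmeasurable_inner_bd) auto
    show "B \<inter> cell t \<in> lmeasurable"
      using mB open_cell by (rule lmeasurable_Int_open)
  qed
  also have "\<dots> = vol B" using mB by (rule vol_eq_sum_cells[symmetric])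
  also have "\<dots> \<le> vol (inner_bd e W) + vol (\<Union>i. S i)"
    unfolding B_def using mI oS(1) by (intro measure_Un_le) (auto intro!: lborelD borel_open)
  also have "vol (\<Union>i. S i) \<le> (\<Sum>i\<in>UNIV. vol (S i))"
    using mS by (intro measure_UNION_le) auto
  also have "\<dots> \<le> (\<Sum>i\<in>(UNIV::'m set). vol (inner_bd (3*e) W))"
    unfolding S_def using W e by (intro sum_mono vol_slab_le)
  also have "vol (inner_bd e W) \<le> vol (inner_bd (3*e) W)"
    using mI e by (intro vol_mono inner_bd_mono) auto
  finally show ?thesis by (simp add: algebra_simps)
qed

text \<open>Two points of \<open>W\<close> on opposite sides of a hyperplane would differ by more
  than \<open>2 * d\<close> in that coordinate. So \<open>W\<close> lies in a single cell and no new
  boundary appears.\<close>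

lemma sum_inner_bd_cells_le_uncut:
  fixes W :: "(real^'m) set"
  assumes W: "open W" "W \<subseteq> unit_cube"
    and small: "\<And>x y i. x \<in> W \<Longrightarrow> y \<in> W \<Longrightarrow> \<bar>x $ i - y $ i\<bar> \<le> d"
    and far: "\<And>x i. x \<in> W \<Longrightarrow> d < \<bar>x $ i - 1/2\<bar>"
  shows "(\<Sum>t\<in>UNIV. vol (inner_bd e (W \<inter> cell t))) \<le> vol (inner_bd e W)"
proof -
  have mI: "inner_bd e W \<in> lmeasurable" using W by (rule lmeasurable_inner_bd)
  have sub: "W \<inter> cell t = {} \<or> W \<subseteq> cell t" for t
  proof (rule disjCI)
    assume "\<not> W \<subseteq> cell t"
    then obtain y i where y: "y \<in> W" "\<not> (if i \<in> t then y $ i > 1/2 else y $ i < 1/2)"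
      by (auto simp: cell_def)
    show "W \<inter> cell t = {}"
    proof (intro equals0I)
      fix x assume "x \<in> W \<inter> cell t"
      then have "x \<in> W" "i \<in> t \<and> x $ i > 1/2 \<or> i \<notin> t \<and> x $ i < 1/2" using cell_cases by blast+
      with y small[of x y i] far[of x i] far[of y i] show False by (auto split: if_splits)
    qed
  qed
  have "(\<Sum>t\<in>UNIV. vol (inner_bd e (W \<inter> cell t))) \<le> (\<Sum>t\<in>UNIV. vol (inner_bd e W \<inter> cell t))"
  proof (intro sum_mono)
    fix t :: "'m set"
    show "vol (inner_bd e (W \<inter> cell t)) \<le> vol (inner_bd e W \<inter> cell t)"
    proof (cases "W \<inter> cell t = {}")
      case True
      then have "inner_bd e (W \<inter> cell t) = {}" using inner_bd_subset by blast
      then show ?thesis by simp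
    next
      case False
      with sub have "W \<subseteq> cell t" by blast
      then have "W \<inter> cell t = W" "inner_bd e W \<inter> cell t = inner_bd e W"
        using inner_bd_subset[of e W] by blast+
      then show ?thesis by simp
    qed
  qed
  also have "\<dots> = vol (inner_bd e W)" using mI by (rule vol_eq_sum_cells[symmetric])
  finally show ?thesis .
qed

section \<open>Linear maps multiply volume by a constant\<close>

lemma vol_cboxes_preserved:
  fixes f :: "'a::euclidean_space \<Rightarrow> 'a"
  assumes "linear f" "\<And>a b. vol (f ` cbox a b) = vol (cbox a b)"
  shows "\<exists>D\<ge>0. \<forall>S\<in>lmeasurable. f ` S \<in> lmeasurable \<and> vol (f ` S) = D * vol S"
proof (intro exI[of _ 1] conjI ballI)
  fix S :: "'a set" assume "S \<in> lmeasurable"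
  with measure_linear_sufficient[OF assms(1), of S 1] assms(2)
  show "f ` S \<in> lmeasurable" "vol (f ` S) = 1 * vol S" by simp_all
qed simp

text \<open>The library computes the factor as a determinant, but only for index types that are
  well-ordered; its bare existence holds for every finite index type.\<close>

lemma vol_linear_image:
  fixes f :: "real^'m \<Rightarrow> real^'m"
  assumes "linear f"
  shows "\<exists>D\<ge>0. \<forall>S\<in>lmeasurable. f ` S \<in> lmeasurable \<and> vol (f ` S) = D * vol S"
proof (rule induct_linear_elementary[OF assms])
  fix f g :: "real^'m \<Rightarrow> real^'m"
  assume "\<exists>D\<ge>0. \<forall>S\<in>lmeasurable. f ` S \<in> lmeasurable \<and> vol (f ` S) = D * vol S"
    "\<exists>D\<ge>0. \<forall>S\<in>lmeasurable. g ` S \<in> lmeasurable \<and> vol (g ` S) = D * vol S"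
  then obtain D D' where D: "D \<ge> 0" "\<forall>S\<in>lmeasurable. f ` S \<in> lmeasurable \<and> vol (f ` S) = D * vol S"
    "D' \<ge> 0" "\<forall>S\<in>lmeasurable. g ` S \<in> lmeasurable \<and> vol (g ` S) = D' * vol S" by blast
  then show "\<exists>D\<ge>0. \<forall>S\<in>lmeasurable. (f \<circ> g) ` S \<in> lmeasurable \<and> vol ((f \<circ> g) ` S) = D * vol S"
    unfolding image_comp[symmetric] by (metis (no_types, lifting) mult.assoc mult_nonneg_nonneg)
next
  fix f :: "real^'m \<Rightarrow> real^'m" and i
  assume f: "linear f" "\<And>x. f x $ i = 0"
  have "negligible (f ` S)" for S
    by (rule negligible_subset[OF negligible_standard_hyperplane_cart[of i]]) (use f in auto)
  then show "\<exists>D\<ge>0. \<forall>S\<in>lmeasurable. f ` S \<in> lmeasurable \<and> vol (f ` S) = D * vol S"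
    by (intro exI[of _ 0]) (auto simp: negligible_iff_measure)
next
  fix c :: "'m \<Rightarrow> real"
  show "\<exists>D\<ge>0. \<forall>S\<in>lmeasurable. (\<lambda>x. \<chi> i. c i * x $ i) ` S \<in> lmeasurable \<and>
      vol ((\<lambda>x. \<chi> i. c i * x $ i) ` S) = D * vol S"
    by (intro exI[of _ "\<bar>prod c UNIV\<bar>"]) (auto simp: measurable_stretch measure_stretch)
next
  fix m n :: 'm
  let ?h = "\<lambda>x::real^'m. \<chi> i. x $ Transposition.transpose m n i"
  have lin: "linear ?h" by (rule linearI) (auto simp: vec_eq_iff)
  have "vol (?h ` cbox a b) = 1 * vol (cbox a b)" for a b
  proof (cases "cbox a b = {}")
    case False
    have eq: "?h ` cbox a b = cbox (?h a) (?h b)"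
      by (auto simp: image_iff lambda_swap_Galois mem_box_cart) (metis transpose_involutory)+
    with False have "cbox (?h a) (?h b) \<noteq> {}" by blast
    then show ?thesis
      using prod.permute[OF permutes_swap_id, where S=UNIV and g="\<lambda>i. (b - a) $ i", symmetric]
      by (simp add: eq content_cbox_cart False)
  qed simp
  then show "\<exists>D\<ge>0. \<forall>S\<in>lmeasurable. ?h ` S \<in> lmeasurable \<and> vol (?h ` S) = D * vol S"
    by (intro vol_cboxes_preserved lin) simp
next
  fix m n :: 'm
  assume mn: "m \<noteq> n"
  let ?h = "\<lambda>x::real^'m. \<chi> i. if i = m then x $ m + x $ n else x $ i"
  have lin: "linear ?h" by (rule linearI) (auto simp: vec_eq_iff algebra_simps)
  have "vol (?h ` cbox a b) = 1 * vol (cbox a b)" for a b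
  proof (cases "cbox a b = {}")
    case False
    \<comment> \<open>This translation makes the \<open>n\<close>-th coordinate of the lower corner
      0, since \<open>measure_shear_interval\<close> requires it to be nonnegative.\<close>
    let ?v = "\<chi> i. if i = n then - a $ n else 0"
    have ne: "cbox (?v + a) (?v + b) \<noteq> {}" using False by (simp add: cbox_translation)
    have "?h ` cbox a b = (+) (\<chi> i. if i = m \<or> i = n then a $ n else 0) ` ?h ` (+) ?v ` cbox a b"
      unfolding image_image using mn by (intro image_cong) (auto simp: vec_eq_iff)
    then have "vol (?h ` cbox a b) = vol (?h ` (+) ?v ` cbox a b)"
      by (rule ssubst) (rule measure_translation)
    also have "\<dots> = vol (?h ` cbox (?v + a) (?v + b))" by (simp only: cbox_translation)
    also have "\<dots> = vol (cbox (?v + a) (?v + b))"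
      by (rule measure_shear_interval[OF mn ne]) simp
    also have "\<dots> = vol (cbox a b)" by (simp only: cbox_translation measure_translation)
    finally show ?thesis by simp
  qed simp
  then show "\<exists>D\<ge>0. \<forall>S\<in>lmeasurable. ?h ` S \<in> lmeasurable \<and> vol (?h ` S) = D * vol S"
    by (intro vol_cboxes_preserved lin) simp
qed

text \<open>The factor is not 0 because the image of a ball is open and nonempty, hence not
  null.\<close>

lemma vol_linear_inj_image:
  fixes f :: "real^'m \<Rightarrow> real^'m"
  assumes "linear f" "inj f"
  shows "\<exists>D>0. \<forall>S\<in>lmeasurable. f ` S \<in> lmeasurable \<and> vol (f ` S) = D * vol S"
proof -
  obtain D where D: "D \<ge> 0" "\<forall>S\<in>lmeasurable. f ` S \<in> lmeasurable \<and> vol (f ` S) = D * vol S"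
    using vol_linear_image[OF assms(1)] by blast
  have "open (f ` ball 0 1)"
    using assms by (intro open_surjective_linear_image linear_injective_imp_surjective) auto
  then have "\<not> negligible (f ` ball (0::real^'m) 1)"
    using open_not_negligible[of "f ` ball 0 1"] by auto
  then have "vol (f ` ball (0::real^'m) 1) \<noteq> 0"
    using D(2) lmeasurable_ball[of "0::real^'m" 1] negligible_iff_measure by blast
  moreover have "vol (f ` ball (0::real^'m) 1) = D * vol (ball (0::real^'m) 1)" using D(2) by simp
  ultimately show ?thesis using D by (intro exI[of _ D]) auto
qed

section \<open>Cutting open sets into narrow strips\<close>

lemma inner_bd_strip:
  fixes W :: "(real^'m) set"
  shows "inner_bd e (W \<inter> {x. a < x $ i \<and> x $ i < b})
    \<subseteq> (inner_bd e W \<union> (W \<inter> {x. \<bar>x $ i - a\<bar> < e \<or> \<bar>x $ i - b\<bar> < e})) \<inter> {x. a < x $ i \<and> x $ i < b}"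
proof
  fix x assume "x \<in> inner_bd e (W \<inter> {x. a < x $ i \<and> x $ i < b})"
  then obtain y where x: "x \<in> W" "a < x $ i" "x $ i < b"
    and y: "y \<in> W \<longrightarrow> \<not> (a < y $ i \<and> y $ i < b)" "dist x y < e"
    by (auto simp: inner_bd_def)
  show "x \<in> (inner_bd e W \<union> (W \<inter> {x. \<bar>x $ i - a\<bar> < e \<or> \<bar>x $ i - b\<bar> < e})) \<inter> {x. a < x $ i \<and> x $ i < b}"
  proof (cases "y \<in> W")
    case False then show ?thesis using x y by (auto simp: inner_bd_def)
  next
    case True
    have "\<bar>x $ i - y $ i\<bar> < e" using y(2) abs_component_diff_le[of x i y] by linarith
    then have "\<bar>x $ i - a\<bar> < e \<or> \<bar>x $ i - b\<bar> < e" using True x y(1) by linarith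
    then show ?thesis using x by auto
  qed
qed

text \<open>Cut \<open>W\<close> by parallel hyperplanes at distance \<open>w\<close> and add up the
  bounds for the strips. With the offset from \<open>grid_offset_exists\<close> the new collars have
  volume at most \<open>4 / w * e * vol W\<close>. Being proportional to \<open>vol W\<close>, this
  cost goes into the coefficient \<open>b\<close>, while \<open>a\<close> and \<open>e\<close> stay
  as they were.\<close>

lemma volume_bound_slice:
  fixes W E :: "(real^'m) set"
  assumes W: "open W" "W \<subseteq> unit_cube" and E: "closed E" and e: "e > 0" and w: "w > 0" and a: "a \<ge> 0"
    and bound: "\<And>V. open V \<Longrightarrow> V \<subseteq> W \<Longrightarrow> (\<And>x y. x \<in> V \<Longrightarrow> y \<in> V \<Longrightarrow> \<bar>x $ i - y $ i\<bar> \<le> w) \<Longrightarrow>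
      vol V \<le> a * vol (inner_bd e V) + b * vol V + d * vol (V - E)"
  shows "vol W \<le> a * vol (inner_bd e W) + (b + a * (4 / w * e)) * vol W + d * vol (W - E)"
proof -
  have mW: "W \<in> lmeasurable" using W by (rule lmeasurable_open_subset_cube)
  have mWE: "W - E \<in> lmeasurable"
    using W E by (intro lmeasurable_open_subset_cube open_Diff) auto
  have mI: "inner_bd e W \<in> lmeasurable" using W by (rule lmeasurable_inner_bd)
  obtain s where s: "0 \<le> s" "s < w"
    "vol (W \<inter> {x. \<exists>l::int. \<bar>x $ i - (s + of_int l * w)\<bar> < e}) \<le> 4 / w * e * vol W"
    using grid_offset_exists[OF mW e w] by blast
  define G where "G = {x::real^'m. \<exists>l::int. \<bar>x $ i - (s + of_int l * w)\<bar> < e}"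
  have "G = (\<Union>l::int. {x. \<bar>x $ i - (s + of_int l * w)\<bar> < e})" by (auto simp: G_def)
  then have oG: "open G" by (simp add: open_UN open_slab)
  have mG: "W \<inter> G \<in> lmeasurable" using mW oG by (rule lmeasurable_Int_open)
  define R where "R = (\<lambda>l::int. {x::real^'m. s + of_int l * w < x $ i \<and> x $ i < s + of_int (l + 1) * w})"
  have oR: "open (R l)" for l unfolding R_def by (rule open_coord_strip)
  \<comment> \<open>Only these strips can meet the cube; the index -1 covers the part below the
    offset \<open>s\<close>.\<close>
  define L where "L = {-1..\<lceil>1 / w\<rceil>}"
  have disj: "disjoint_family_on R L"
  proof -
    have "R k \<inter> R l = {}" if "k < l" for k l
    proof -
      have "of_int (k + 1) * w \<le> of_int l * w" using that w by (intro mult_right_mono) auto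
      then show ?thesis by (auto simp: R_def)
    qed
    then show ?thesis unfolding disjoint_family_on_def by (metis Int_commute linorder_neqE)
  qed
  have sum_eq: "vol X = (\<Sum>l\<in>L. vol (X \<inter> R l))" if "X \<in> lmeasurable" "X \<subseteq> W" for X
  proof (rule sum_vol_partition[OF _ that(1) oR disj])
    show "negligible (X - (\<Union>l\<in>L. R l))"
    proof (rule negligible_subset)
      show "negligible (\<Union>l\<in>L. {x::real^'m. x $ i = s + of_int l * w})"
        unfolding L_def by (rule negligible_Union) (simp, use negligible_coord_eq in blast)
      show "X - (\<Union>l\<in>L. R l) \<subseteq> (\<Union>l\<in>L. {x. x $ i = s + of_int l * w})"
      proof
        fix x assume x: "x \<in> X - (\<Union>l\<in>L. R l)"
        then have xi: "0 \<le> x $ i" "x $ i \<le> 1" using that W by (auto simp: unit_cube_def)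
        define l where "l = \<lfloor>(x $ i - s) / w\<rfloor>"
        have l: "of_int l \<le> (x $ i - s) / w" "(x $ i - s) / w < of_int l + 1"
          unfolding l_def by linarith+
        have "-1 < (x $ i - s) / w" using xi s w by (simp add: field_simps)
        moreover have "(x $ i - s) / w \<le> 1 / w"
          using xi s w by (intro divide_right_mono) auto
        ultimately have "l \<in> L" using l unfolding L_def by (simp; linarith)
        moreover have "s + of_int l * w \<le> x $ i" "x $ i < s + of_int (l + 1) * w"
          using l w by (auto simp: field_simps)
        ultimately show "x \<in> (\<Union>l\<in>L. {x. x $ i = s + of_int l * w})"
          using x by (force simp: R_def)
      qed
    qed
  qed (simp add: L_def)
  have mIG: "inner_bd e W \<union> (W \<inter> G) \<in> lmeasurable"
    using mI mG by (rule fmeasurable.Un)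
  have "(\<Sum>l\<in>L. vol (inner_bd e (W \<inter> R l))) \<le> (\<Sum>l\<in>L. vol ((inner_bd e W \<union> (W \<inter> G)) \<inter> R l))"
  proof (intro sum_mono vol_mono)
    fix l
    have "{x. \<bar>x $ i - (s + of_int l * w)\<bar> < e \<or> \<bar>x $ i - (s + of_int (l + 1) * w)\<bar> < e} \<subseteq> G"
      unfolding G_def by blast
    then show "inner_bd e (W \<inter> R l) \<subseteq> (inner_bd e W \<union> (W \<inter> G)) \<inter> R l"
      unfolding R_def using inner_bd_strip by blast
    show "inner_bd e (W \<inter> R l) \<in> lmeasurable"
      using W oR by (intro lmeasurable_inner_bd open_Int) auto
    show "(inner_bd e W \<union> (W \<inter> G)) \<inter> R l \<in> lmeasurable"
      using mIG oR by (rule lmeasurable_Int_open)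
  qed
  also have "\<dots> = vol (inner_bd e W \<union> (W \<inter> G))"
    using mIG inner_bd_subset by (intro sum_eq[symmetric]) auto
  also have "\<dots> \<le> vol (inner_bd e W) + vol (W \<inter> G)"
    using mI mG by (intro measure_Un_le) auto
  also have "\<dots> \<le> vol (inner_bd e W) + 4 / w * e * vol W"
    using s(3) by (simp add: G_def)
  finally have bd: "(\<Sum>l\<in>L. vol (inner_bd e (W \<inter> R l))) \<le> vol (inner_bd e W) + 4 / w * e * vol W" .
  have "vol (W \<inter> R l) \<le> a * vol (inner_bd e (W \<inter> R l)) + b * vol (W \<inter> R l) + d * vol ((W - E) \<inter> R l)" for l
  proof -
    have "(W \<inter> R l) - E = (W - E) \<inter> R l" by auto
    moreover have "\<bar>x $ i - y $ i\<bar> \<le> w" if "x \<in> W \<inter> R l" "y \<in> W \<inter> R l" for x y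
      using that by (auto simp: R_def algebra_simps)
    ultimately show ?thesis using bound[of "W \<inter> R l"] open_Int[OF W(1) oR[of l]] by auto
  qed
  then have "(\<Sum>l\<in>L. vol (W \<inter> R l)) \<le>
      (\<Sum>l\<in>L. a * vol (inner_bd e (W \<inter> R l)) + b * vol (W \<inter> R l) + d * vol ((W - E) \<inter> R l))"
    by (rule sum_mono)
  also have "\<dots> = a * (\<Sum>l\<in>L. vol (inner_bd e (W \<inter> R l))) + b * vol W + d * vol (W - E)"
    using sum_eq[OF mW] sum_eq[OF mWE] by (simp add: sum.distrib sum_distrib_left)
  also have "\<dots> \<le> a * (vol (inner_bd e W) + 4 / w * e * vol W) + b * vol W + d * vol (W - E)"
    using bd a by (intro add_right_mono mult_left_mono) auto
  finally show ?thesis using sum_eq[OF mW] by (simp add: algebra_simps)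
qed

text \<open>The coordinates are sliced one after another. The induction generalises over
  \<open>b\<close>, since each slicing passes on a larger coefficient.\<close>

lemma volume_bound_slice_all:
  fixes W E :: "(real^'m) set"
  assumes E: "closed E" and e: "e > 0" and w: "w > 0" and a: "a \<ge> 0" and fin: "finite S"
    and bound: "\<And>V. open V \<Longrightarrow> V \<subseteq> unit_cube \<Longrightarrow>
      (\<And>x y i. x \<in> V \<Longrightarrow> y \<in> V \<Longrightarrow> i \<in> S \<Longrightarrow> \<bar>x $ i - y $ i\<bar> \<le> w) \<Longrightarrow>
      vol V \<le> a * vol (inner_bd e V) + b * vol V + d * vol (V - E)"
    and W: "open W" "W \<subseteq> unit_cube"
  shows "vol W \<le> a * vol (inner_bd e W) + (b + real (card S) * (a * (4 / w * e))) * vol W + d * vol (W - E)"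
  using fin bound W
proof (induction S arbitrary: b W rule: finite_induct)
  case empty
  then show ?case by simp
next
  case (insert i S)
  have "vol V \<le> a * vol (inner_bd e V) + (b + a * (4 / w * e)) * vol V + d * vol (V - E)"
    if V: "open V" "V \<subseteq> unit_cube"
      "\<And>x y j. x \<in> V \<Longrightarrow> y \<in> V \<Longrightarrow> j \<in> S \<Longrightarrow> \<bar>x $ j - y $ j\<bar> \<le> w" for V
  proof (rule volume_bound_slice[OF V(1,2) E e w a])
    fix V' assume V': "open V'" "V' \<subseteq> V"
      "\<And>x y. x \<in> V' \<Longrightarrow> y \<in> V' \<Longrightarrow> \<bar>x $ i - y $ i\<bar> \<le> w"
    have "\<bar>x $ j - y $ j\<bar> \<le> w" if "x \<in> V'" "y \<in> V'" "j \<in> insert i S" for x y j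
      using that V' V(3) by blast
    then show "vol V' \<le> a * vol (inner_bd e V') + b * vol V' + d * vol (V' - E)"
      using V V' by (intro insert.prems) blast+
  qed
  from insert.IH[OF this insert.prems(2,3)]
  have "vol W \<le> a * vol (inner_bd e W) +
      (b + a * (4 / w * e) + real (card S) * (a * (4 / w * e))) * vol W + d * vol (W - E)" .
  moreover have "b + Q + real (card S) * Q = b + real (card (insert i S)) * Q" for Q
    using insert.hyps by (simp add: distrib_right)
  ultimately show ?case by (simp only:)
qed

section \<open>Boxes: collars, and boxes nearly filled by a closed set\<close>

lemma vol_cube_slab_le:
  assumes "e > 0"
  shows "vol (unit_cube \<inter> {x::real^'m. \<bar>x $ i - c\<bar> < e}) \<le> 2 * e"
proof -
  define a b where "a = (\<chi> j. if j = i then c - e else 0)" "b = (\<chi> j. if j = i then c + e else 1)"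
  have ne: "cbox a b \<noteq> {}" using assms by (auto simp: a_b_def interval_ne_empty_cart)
  have "vol (unit_cube \<inter> {x::real^'m. \<bar>x $ i - c\<bar> < e}) \<le> vol (cbox a b)"
  proof (rule vol_mono)
    show "unit_cube \<inter> {x::real^'m. \<bar>x $ i - c\<bar> < e} \<in> lmeasurable"
      by (rule lmeasurable_Int_open[OF _ open_slab]) (simp add: unit_cube_eq_cbox)
  qed (auto simp: a_b_def mem_box_cart unit_cube_def)
  also have "\<dots> = (\<Prod>j\<in>UNIV. b $ j - a $ j)" using content_cbox_cart[OF ne] by simp
  also have "\<dots> = (\<Prod>j\<in>UNIV. if j = i then 2 * e else 1)"
    by (intro prod.cong) (auto simp: a_b_def)
  also have "\<dots> = 2 * e" by simp
  finally show ?thesis .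
qed

lemma vol_inner_bd_box_le:
  fixes u v :: "real^'m"
  assumes "box u v \<subseteq> unit_cube" "e > 0"
  shows "vol (inner_bd e (box u v)) \<le> 4 * real CARD('m) * e"
proof -
  define S where "S = (\<lambda>c i. unit_cube \<inter> {x::real^'m. \<bar>x $ i - c\<bar> < e})"
  have mS: "S c i \<in> lmeasurable" for c i
    unfolding S_def by (rule lmeasurable_Int_open[OF _ open_slab]) (simp add: unit_cube_eq_cbox)
  have "inner_bd e (box u v) \<subseteq> (\<Union>i. S (u $ i) i \<union> S (v $ i) i)"
  proof
    fix x assume "x \<in> inner_bd e (box u v)"
    then obtain y where x: "x \<in> box u v" and y: "y \<notin> box u v" "dist x y < e"
      by (auto simp: inner_bd_def)
    then obtain i where i: "\<not> (u $ i < y $ i \<and> y $ i < v $ i)" by (auto simp: mem_box_cart)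
    have "\<bar>x $ i - y $ i\<bar> < e" using y(2) abs_component_diff_le[of x i y] by linarith
    moreover have "u $ i < x $ i \<and> x $ i < v $ i" using x by (simp add: mem_box_cart)
    ultimately have "\<bar>x $ i - u $ i\<bar> < e \<or> \<bar>x $ i - v $ i\<bar> < e" using i by linarith
    then show "x \<in> (\<Union>i. S (u $ i) i \<union> S (v $ i) i)" using x assms by (auto simp: S_def)
  qed
  then have "vol (inner_bd e (box u v)) \<le> vol (\<Union>i. S (u $ i) i \<union> S (v $ i) i)"
    using assms mS by (intro vol_mono lmeasurable_inner_bd open_box fmeasurable.finite_UN fmeasurable.Un) auto
  also have "\<dots> \<le> (\<Sum>i\<in>UNIV. vol (S (u $ i) i \<union> S (v $ i) i))"
    using mS by (intro measure_UNION_le) auto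
  also have "\<dots> \<le> (\<Sum>i\<in>(UNIV::'m set). 4 * e)"
  proof (rule sum_mono)
    fix i
    have "vol (S (u $ i) i \<union> S (v $ i) i) \<le> vol (S (u $ i) i) + vol (S (v $ i) i)"
      using mS by (intro measure_Un_le) auto
    then show "vol (S (u $ i) i \<union> S (v $ i) i) \<le> 4 * e"
      using vol_cube_slab_le[OF assms(2), of i "u $ i"] vol_cube_slab_le[OF assms(2), of i "v $ i"]
      by (simp add: S_def)
  qed
  finally show ?thesis by simp
qed

text \<open>A density statement obtained from outer covers: if boxes cover \<open>E\<close> with
  little excess, the excess cannot be a large fraction of every box.\<close>

lemma dense_box_exists:
  fixes E :: "(real^'m) set"
  assumes E: "closed E" "E \<subseteq> unit_cube" "\<not> negligible E" and \<eta>: "\<eta> > 0"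
  obtains u v where "box u v \<subseteq> unit_cube" "box u v \<noteq> {}" "vol (box u v - E) \<le> \<eta> * vol (box u v)"
proof -
  have mE: "E \<in> lmeasurable"
    using E by (intro lmeasurable_compact) (metis bounded_cbox bounded_subset compact_eq_bounded_closed unit_cube_eq_cbox)
  then have posE: "vol E > 0" using E(3) negligible_iff_measure by (metis measure_nonneg order_le_less)
  \<comment> \<open>If every box had more than the fraction \<open>\<eta>\<close> outside
    \<open>E\<close>, the cover would have volume at most \<open>r / \<eta> = vol E / 2\<close>, too
    little to cover \<open>E\<close>.\<close>
  define r where "r = \<eta> * vol E / 2"
  have r: "r > 0" using posE \<eta> by (simp add: r_def)
  have Ecb: "E \<subseteq> cbox 0 (\<chi> i. 1)" using E(2) by (simp add: unit_cube_eq_cbox)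
  show thesis
  proof (rule measurable_outer_intervals_bounded[OF mE Ecb r])
    fix \<D> :: "(real^'m) set set"
    assume \<D>: "countable \<D>"
      "\<And>K. K \<in> \<D> \<Longrightarrow> K \<subseteq> cbox 0 (\<chi> i. 1) \<and> K \<noteq> {} \<and> (\<exists>c d. K = cbox c d)"
      "pairwise (\<lambda>A B. interior A \<inter> interior B = {}) \<D>"
      "\<And>K. \<lbrakk>K \<in> \<D>; box 0 (\<chi> i. (1::real)) \<noteq> ({} :: (real^'m) set)\<rbrakk> \<Longrightarrow> interior K \<noteq> {}"
      "E \<subseteq> \<Union>\<D>" "\<Union>\<D> \<in> lmeasurable" "vol (\<Union>\<D>) \<le> vol E + r"
    have ne: "box 0 (\<chi> i. (1::real)) \<noteq> ({} :: (real^'m) set)"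
      by (auto simp: interval_ne_empty_cart)
    have mX: "\<Union>\<D> - E \<in> lmeasurable" using \<D>(6) mE by (rule fmeasurable.Diff)
    have volX: "vol (\<Union>\<D> - E) \<le> r"
      using \<D>(5,6,7) mE by (simp add: measurable_measure_Diff)
    have mK: "K \<in> lmeasurable" "interior K \<in> lmeasurable" "vol (interior K) = vol K" if "K \<in> \<D>" for K
      using \<D>(2)[OF that] by (auto simp: measure_lborel_box_eq measure_lborel_cbox_eq)
    have "\<exists>K\<in>\<D>. vol (interior K - E) \<le> \<eta> * vol (interior K)"
    proof (rule ccontr)
      assume neg: "\<not> ?thesis"
      have "vol (\<Union>F) \<le> vol E / 2" if F: "F \<subseteq> \<D>" "finite F" for F
      proof -
        have "\<eta> * vol (\<Union>F) \<le> \<eta> * (\<Sum>K\<in>F. vol K)"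
          using F mK \<eta> by (intro mult_left_mono measure_Union_le) auto
        also have "\<dots> = (\<Sum>K\<in>F. \<eta> * vol (interior K))"
          using F mK by (simp add: sum_distrib_left subset_eq)
        also have "\<dots> \<le> (\<Sum>K\<in>F. vol ((\<Union>\<D> - E) \<inter> interior K))"
        proof (rule sum_mono)
          fix K assume K: "K \<in> F"
          then have "(\<Union>\<D> - E) \<inter> interior K = interior K - E" using F interior_subset by blast
          then show "\<eta> * vol (interior K) \<le> vol ((\<Union>\<D> - E) \<inter> interior K)" using neg K F by force
        qed
        also have "\<dots> \<le> vol (\<Union>\<D> - E)"
          using F \<D>(3) mX by (intro sum_vol_disjoint_le) (auto simp: disjoint_family_on_def pairwise_def subset_eq)
        also have "\<dots> \<le> \<eta> * (vol E / 2)" using volX by (simp add: r_def)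
        finally show ?thesis using \<eta> by simp
      qed
      from measure_Union_bound[OF \<D>(1) mK(1) this] have "vol (\<Union>\<D>) \<le> vol E / 2" by simp
      moreover have "vol E \<le> vol (\<Union>\<D>)" using \<D>(5,6) mE by (intro vol_mono)
      ultimately show False using posE by simp
    qed
    then obtain K where K: "K \<in> \<D>" "vol (interior K - E) \<le> \<eta> * vol (interior K)" by blast
    obtain u v where uv: "K = cbox u v" using \<D>(2)[OF K(1)] by blast
    show thesis
      using that[of u v] K \<D>(2)[OF K(1)] \<D>(4)[OF K(1) ne] box_subset_cbox[of u v]
      by (auto simp: uv unit_cube_eq_cbox)
  qed
qed

section \<open>The coupled map for small coupling\<close>

lemma tent_bounds: "0 \<le> x \<Longrightarrow> x \<le> 1 \<Longrightarrow> 0 \<le> tent x \<and> tent x \<le> 1"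
  by (auto simp: tent_def abs_if)

lemma tent_lipschitz: "\<bar>tent x - tent y\<bar> \<le> 2 * \<bar>x - y\<bar>"
  by (auto simp: tent_def abs_if)

lemma tent_vec_cube: "x \<in> unit_cube \<Longrightarrow> tent_vec x \<in> unit_cube"
  by (auto simp: unit_cube_def tent_vec_def tent_bounds)

lemma dist_tent_vec: "dist (tent_vec x) (tent_vec y) \<le> 2 * dist x (y::real^'m)"
proof -
  have "norm (tent_vec x - tent_vec y) \<le> norm (2 *\<^sub>R (x - y))"
  proof (rule norm_le_componentwise_cart)
    show "norm ((tent_vec x - tent_vec y) $ i) \<le> norm ((2 *\<^sub>R (x - y)) $ i)" for i
    proof -
      have "(2 *\<^sub>R (x - y)) $ i = 2 * (x $ i - y $ i)" by simp
      then show ?thesis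
        using tent_lipschitz[of "x $ i" "y $ i"]
        by (simp only: tent_vec_def abs_mult vector_minus_component vec_lambda_beta real_norm_def)
    qed
  qed
  then show ?thesis by (simp add: dist_norm)
qed

text \<open>\<open>norm_small\<close> makes every branch expand by at least
  \<open>2 * (1 - 1/4) = 3/2\<close>. \<open>component_small\<close> keeps the deviation from the
  uncoupled map below 1/64 for \<open>K\<close> steps, because older errors at most double at each
  step.\<close>

locale small_coupling =
  fixes A :: "real^'m^'m" and c :: real and K :: nat
  assumes cube: "\<And>x. x \<in> unit_cube \<Longrightarrow> coupling c A *v x \<in> unit_cube"
    and norm_small: "\<And>v. norm ((c *\<^sub>R A) *v v) \<le> norm v / 4"
    and component_small: "\<And>x i. x \<in> unit_cube \<Longrightarrow> \<bar>((c *\<^sub>R A) *v x) $ i\<bar> \<le> 1 / (64 * 2 ^ K)"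
begin

abbreviation "T \<equiv> cml c A"

text \<open>The affine formula for \<open>T\<close> on \<open>cell t\<close>, extended to the whole
  space, where it is a bijection; \<open>slope\<close> is its linear part.\<close>

definition branch :: "'m set \<Rightarrow> real^'m \<Rightarrow> real^'m" where
  "branch t x = coupling c A *v (\<chi> i. if i \<in> t then 2 - 2 * x $ i else 2 * x $ i)"

definition slope :: "'m set \<Rightarrow> real^'m \<Rightarrow> real^'m" where
  "slope t v = coupling c A *v (\<chi> i. if i \<in> t then - 2 * v $ i else 2 * v $ i)"

lemma coupling_mult: "coupling c A *v v = v + (c *\<^sub>R A) *v v"
  by (simp add: coupling_def matrix_vector_mult_add_rdistrib)

lemma norm_coupling: "3/4 * norm v \<le> norm (coupling c A *v v)" "norm (coupling c A *v v) \<le> 5/4 * norm v"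
  using norm_small[of v] norm_triangle_ineq[of v "(c *\<^sub>R A) *v v"]
    norm_triangle_ineq2[of v "- ((c *\<^sub>R A) *v v)"]
  by (auto simp: coupling_mult)

lemma T_cube: "x \<in> unit_cube \<Longrightarrow> T x \<in> unit_cube"
  by (simp add: cml_def cube tent_vec_cube)

lemma T_funpow_cube: "x \<in> unit_cube \<Longrightarrow> (T ^^ n) x \<in> unit_cube"
  by (induction n) (auto intro: T_cube)

lemma dist_T: "dist (T x) (T y) \<le> 3 * dist x y"
proof -
  have "T x - T y = coupling c A *v (tent_vec x - tent_vec y)"
    by (simp add: cml_def matrix_vector_mult_diff_distrib)
  then have "dist (T x) (T y) \<le> 5/4 * dist (tent_vec x) (tent_vec y)"
    using norm_coupling(2) by (simp add: dist_norm)
  then show ?thesis using dist_tent_vec[of x y] zero_le_dist[of x y] by linarith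
qed

lemma dist_T_funpow: "dist ((T ^^ n) x) ((T ^^ n) y) \<le> 3 ^ n * dist x y"
proof (induction n)
  case (Suc n)
  then show ?case using dist_T[of "(T ^^ n) x" "(T ^^ n) y"] by simp
qed simp

lemma continuous_T_funpow: "continuous_on S (T ^^ n)"
proof -
  have "(3 ^ n)-lipschitz_on S (T ^^ n)"
    by (intro lipschitz_onI dist_T_funpow) auto
  then show ?thesis by (rule lipschitz_on_continuous_on)
qed

lemma T_component:
  assumes "x \<in> unit_cube"
  shows "\<bar>T x $ i - tent (x $ i)\<bar> \<le> 1 / (64 * 2 ^ K)"
  using component_small[OF tent_vec_cube[OF assms], of i]
  by (simp add: cml_def coupling_mult) (simp add: tent_vec_def)

lemma linear_slope: "linear (slope t)"
proof -
  have "linear (\<lambda>v::real^'m. \<chi> i. if i \<in> t then - 2 * v $ i else 2 * v $ i)"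
    by (rule linearI) (auto simp: vec_eq_iff algebra_simps)
  from linear_compose[OF this matrix_vector_mul_linear[of "coupling c A"]]
  show ?thesis by (simp add: slope_def[abs_def] o_def)
qed

lemma norm_slope: "3/2 * norm v \<le> norm (slope t v)"
proof -
  define u where "u = (\<chi> i. if i \<in> t then - 2 * v $ i else 2 * v $ i)"
  have "norm (2 *\<^sub>R v) \<le> norm u"
    unfolding u_def by (rule norm_le_componentwise_cart) auto
  with norm_coupling(1)[of u] show ?thesis unfolding slope_def u_def[symmetric] by simp
qed

lemma branch_eq: "branch t x = branch t 0 + slope t x"
  unfolding branch_def slope_def matrix_vector_right_distrib[symmetric]
  by (rule arg_cong[where f="(*v) _"]) (auto simp: vec_eq_iff)

lemma inj_slope: "inj (slope t)"
proof -
  have "x = 0" if "slope t x = 0" for x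
    using norm_slope[of x t] that by simp
  then show ?thesis using linear_slope by (simp add: linear_injective_0)
qed

lemma dist_branch: "3/2 * dist x y \<le> dist (branch t x) (branch t y)"
  using norm_slope[of "x - y" t]
  by (simp add: branch_eq[of t x] branch_eq[of t y] dist_norm linear_diff[OF linear_slope])

lemma bij_branch: "bij (branch t)"
proof -
  have "branch t = (+) (branch t 0) \<circ> slope t" by (auto simp: branch_eq[symmetric])
  moreover have "bij (slope t)"
    using inj_slope linear_slope by (simp add: bij_def linear_injective_imp_surjective)
  ultimately show ?thesis using bij_comp bij_plus by metis
qed

lemma image_branch: "branch t ` X = (+) (branch t 0) ` slope t ` X"
  unfolding image_image by (intro image_cong refl branch_eq)

lemma open_branch_image: "open X \<Longrightarrow> open (branch t ` X)"
  unfolding image_branch using linear_slope inj_slope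
  by (metis open_translation open_surjective_linear_image linear_injective_imp_surjective)

lemma vol_branch_image:
  obtains D where "D > 0" "\<And>X. X \<in> lmeasurable \<Longrightarrow> branch t ` X \<in> lmeasurable"
    "\<And>X. X \<in> lmeasurable \<Longrightarrow> vol (branch t ` X) = D * vol X"
proof -
  obtain D where D: "D > 0" "\<And>X. X \<in> lmeasurable \<Longrightarrow> slope t ` X \<in> lmeasurable"
    "\<And>X. X \<in> lmeasurable \<Longrightarrow> vol (slope t ` X) = D * vol X"
    using vol_linear_inj_image[OF linear_slope inj_slope] by metis
  show thesis
    by (rule that[OF D(1)]) (auto simp: image_branch measure_translation D intro!: measurable_translation)
qed

lemma T_eq_branch:
  assumes "x \<in> cell t"
  shows "T x = branch t x"
proof -
  have "tent (x $ i) = (if i \<in> t then 2 - 2 * x $ i else 2 * x $ i)" for i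
    using cell_cases[OF assms, of i] by (auto simp: tent_def)
  then show ?thesis by (simp add: cml_def branch_def tent_vec_def)
qed

lemma T_eq_branch': "T x = branch {i. x $ i > 1/2} x"
  unfolding cml_def branch_def
  by (rule arg_cong[where f="(*v) _"]) (auto simp: vec_eq_iff tent_vec_def tent_def abs_if)

text \<open>An outside point close to \<open>branch t x\<close> is the image of a point outside
  \<open>X\<close>, and by expansion that point is closer to \<open>x\<close> by the factor
  2/3.\<close>

lemma inner_bd_branch: "inner_bd e (branch t ` X) \<subseteq> branch t ` inner_bd (2/3 * e) X"
proof
  fix y assume "y \<in> inner_bd e (branch t ` X)"
  then obtain x z where x: "x \<in> X" "y = branch t x" and z: "z \<notin> branch t ` X" "dist y z < e"
    by (auto simp: inner_bd_def)
  obtain w where w: "z = branch t w" using bij_branch by (metis bij_pointE)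
  then have "w \<notin> X" using z by auto
  moreover have "dist x w < 2/3 * e" using dist_branch[of x w t] z w x by simp
  ultimately show "y \<in> branch t ` inner_bd (2/3 * e) X" using x by (auto simp: inner_bd_def)
qed

text \<open>\<open>T\<close> agrees at each point with one of finitely many branches, whose inverses
  are Lipschitz. This allows initial segments of orbits to be discarded later.\<close>

lemma negligible_vimage_T:
  assumes "negligible X"
  shows "negligible {x. T x \<in> X}"
proof (rule negligible_subset)
  show "negligible (\<Union>t. inv (branch t) ` X)"
  proof (rule negligible_Union)
    show "negligible Y" if Y: "Y \<in> range (\<lambda>t. inv (branch t) ` X)" for Y
    proof -
      obtain t where t: "Y = inv (branch t) ` X" using Y by auto
      have "norm (inv (branch t) y - inv (branch t) x) \<le> 2/3 * norm (y - x)" for x y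
        using dist_branch[of "inv (branch t) y" "inv (branch t) x" t] bij_branch[of t]
        by (simp add: dist_norm surj_f_inv_f bij_is_surj)
      then show ?thesis unfolding t
        by (intro negligible_locally_Lipschitz_image assms) (auto intro!: exI[of _ UNIV] exI[of _ "2/3"])
    qed
  qed simp
  show "{x. T x \<in> X} \<subseteq> (\<Union>t. inv (branch t) ` X)"
  proof
    fix x assume "x \<in> {x. T x \<in> X}"
    moreover define t where "t = {i. x $ i > 1/2}"
    ultimately have "branch t x \<in> X" using T_eq_branch'[of x] by simp
    moreover have "x = inv (branch t) (branch t x)"
      using bij_branch[of t] by (simp add: bij_is_inj)
    ultimately show "x \<in> (\<Union>t. inv (branch t) ` X)" by blast
  qed
qed

lemma negligible_vimage_T_funpow:
  assumes "negligible X"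
  shows "negligible {x. (T ^^ n) x \<in> X}"
proof (induction n)
  case (Suc n)
  from negligible_vimage_T[OF this] show ?case by (simp add: funpow_Suc_right del: funpow.simps)
qed (use assms in simp)

end

section \<open>Growth of pieces\<close>

text \<open>The estimate carried through the dynamics. When it is pulled back in time,
  \<open>a\<close> grows, \<open>e\<close> shrinks, \<open>b\<close> collects the cost of slicing
  and \<open>d\<close> is unchanged. With nonnegative \<open>a\<close> and \<open>d\<close> it is
  informative only while \<open>b\<close> is below 1.\<close>

definition volume_bound :: "(real^'m) set \<Rightarrow> real \<Rightarrow> real \<Rightarrow> real \<Rightarrow> real \<Rightarrow> bool" where
  "volume_bound E e a b d \<longleftrightarrow> (\<forall>W. open W \<and> W \<subseteq> unit_cube \<longrightarrow>
     vol W \<le> a * vol (inner_bd e W) + b * vol W + d * vol (W - E))"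

lemma tent_le: "tent x \<le> 2 * x" "tent x \<le> 2 * (1 - x)"
  by (auto simp: tent_def abs_if)

lemma tent_near_half: "\<bar>x - 1/2\<bar> \<le> e \<Longrightarrow> 1 - 2 * e \<le> tent x"
  by (simp add: tent_def)

context small_coupling
begin

abbreviation \<delta> :: real where "\<delta> \<equiv> 1 / (64 * 2 ^ K)"

text \<open>The times at which a cut can matter: without a hit, hypothesis \<open>far\<close> of
  \<open>sum_inner_bd_cells_le_uncut\<close> holds with \<open>\<delta>\<close> for
  \<open>d\<close>.\<close>

definition hits :: "nat \<Rightarrow> (real^'m) set \<Rightarrow> bool" where
  "hits n W \<longleftrightarrow> (\<exists>i. \<exists>x\<in>W. \<bar>(T ^^ n) x $ i - 1/2\<bar> \<le> \<delta>)"

definition narrow :: "nat \<Rightarrow> (real^'m) set \<Rightarrow> bool" where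
  "narrow k W \<longleftrightarrow> (\<forall>j<k. \<forall>x\<in>W. \<forall>y\<in>W. \<forall>i. \<bar>(T ^^ j) x $ i - (T ^^ j) y $ i\<bar> \<le> \<delta>)"

text \<open>The tent map sends \<open>1/2\<close> to \<open>1\<close> and then to the fixed point \<open>0\<close>, from which it takes
  about \<open>K\<close> steps to return.\<close>

lemma no_early_return:
  assumes x: "x \<in> unit_cube" and near: "\<bar>x $ i - 1/2\<bar> \<le> 2 * \<delta>" and j: "0 < j" "j \<le> K"
  shows "\<delta> < \<bar>(T ^^ j) x $ i - 1/2\<bar>"
proof -
  have T: "\<bar>(T ^^ Suc n) x $ i - tent ((T ^^ n) x $ i)\<bar> \<le> \<delta>" for n
    using T_component[OF T_funpow_cube[OF x], of n i] by simp
  have small: "\<delta> \<le> 1/64" by (simp add: field_simps)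
  have first: "1 - 5 * \<delta> \<le> (T ^^ 1) x $ i"
    using T[of 0] tent_near_half[OF near] by simp
  \<comment> \<open>Adding \<open>\<delta>\<close> on the left turns the recursion
    \<open>u \<le> 2 * v + \<delta>\<close> into a doubling of \<open>v + \<delta>\<close>. The
    initial value is \<open>2 * (5 * \<delta>) + \<delta> + \<delta>\<close>.\<close>
  have later: "(T ^^ Suc (Suc n)) x $ i + \<delta> \<le> 2 ^ n * (12 * \<delta>)" for n
  proof (induction n)
    case 0
    show ?case using T[of 1] tent_le(2)[of "(T ^^ 1) x $ i"] first by simp
  next
    case (Suc n)
    show ?case using T[of "Suc (Suc n)"] tent_le(1)[of "(T ^^ Suc (Suc n)) x $ i"] Suc
      by (simp only: power_Suc)
  qed
  show ?thesis
  proof (cases "j = 1")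
    case True
    then show ?thesis using first small unfolding True by linarith
  next
    case False
    then obtain n where n: "j = Suc (Suc n)" using j by (metis One_nat_def gr0_implies_Suc old.nat.exhaust)
    have "(2::real) ^ n \<le> 2 ^ K" using n j by (intro power_increasing) auto
    then have "2 ^ n * (12 * \<delta>) \<le> 2 ^ K * (12 * \<delta>)" by (intro mult_right_mono) auto
    also have "\<dots> = 12/64" by simp
    finally show ?thesis using later[of n] small unfolding n by linarith
  qed
qed

text \<open>Each coordinate causes at most one hit. Two hits may come from different points of
  \<open>W\<close>; by narrowness the second point was within \<open>2 * \<delta>\<close> of 1/2 at
  the time of the first hit, and \<open>no_early_return\<close> applies to it.\<close>

lemma card_hits_le:
  assumes W: "W \<subseteq> unit_cube" and nar: "narrow K W"
  shows "card {j. j < K \<and> hits j W} \<le> CARD('m)"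
proof -
  define H where "H = (\<lambda>i. {j. j < K \<and> (\<exists>x\<in>W. \<bar>(T ^^ j) x $ i - 1/2\<bar> \<le> \<delta>)})"
  have fin: "finite (H i)" for i by (simp add: H_def)
  have le: False if jl: "j \<in> H i" "l \<in> H i" "j < l" for i j l
  proof -
    obtain x y where xy: "x \<in> W" "y \<in> W" "\<bar>(T ^^ j) x $ i - 1/2\<bar> \<le> \<delta>" "\<bar>(T ^^ l) y $ i - 1/2\<bar> \<le> \<delta>"
      and "j < K" "l < K"
      using jl by (auto simp: H_def)
    have "\<bar>(T ^^ j) x $ i - (T ^^ j) y $ i\<bar> \<le> \<delta>"
      using nar xy \<open>j < K\<close> unfolding narrow_def by blast
    then have "\<bar>(T ^^ j) y $ i - 1/2\<bar> \<le> 2 * \<delta>" using xy(3) by linarith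
    moreover have "(T ^^ j) y \<in> unit_cube" using W xy by (intro T_funpow_cube) auto
    ultimately have "\<delta> < \<bar>(T ^^ (l - j)) ((T ^^ j) y) $ i - 1/2\<bar>"
      using jl(3) \<open>l < K\<close> by (intro no_early_return) auto
    also have "(T ^^ (l - j)) ((T ^^ j) y) = (T ^^ l) y"
      using jl(3) by (metis comp_apply funpow_add le_add_diff_inverse2 less_imp_le)
    finally show False using xy(4) by simp
  qed
  have "card (H i) \<le> 1" for i
    unfolding card_le_Suc0_iff_eq[OF fin, folded One_nat_def] using le by (metis linorder_neqE_nat)
  then have "card (\<Union>i. H i) \<le> (\<Sum>i\<in>(UNIV::'m set). 1)"
    by (intro order_trans[OF card_UN_le sum_mono]) auto
  moreover have "{j. j < K \<and> hits j W} = (\<Union>i. H i)"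
    by (auto simp: H_def hits_def)
  ultimately show ?thesis by simp
qed

text \<open>Cut \<open>W\<close> into cells, apply the induction hypothesis to their images, and
  pull back by the affine branches, each of which scales all volumes by one factor. Every step
  shrinks the collar by 2/3; a step with a hit costs a factor \<open>1 + real CARD('m)\<close> in
  volume and 3 in width.\<close>

lemma volume_bound_pull_back:
  assumes vb: "volume_bound E e a b d" and a: "a \<ge> 0" and b: "b \<ge> 0" and d: "d \<ge> 0" and e: "e > 0"
    and E: "closed E" "\<And>x. x \<in> E \<Longrightarrow> T x \<in> E"
    and W: "open W" "W \<subseteq> unit_cube" "narrow k W"
  defines "h \<equiv> card {j. j < k \<and> hits j W}"
  shows "vol W \<le> a * (1 + real CARD('m)) ^ h * vol (inner_bd (3 ^ h * (2/3) ^ k * e) W)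
    + b * vol W + d * vol (W - E)"
  using W unfolding h_def
proof (induction k arbitrary: W)
  case 0
  then show ?case using vb by (simp add: volume_bound_def)
next
  case (Suc k)
  note W = Suc.prems
  define q where "q = 1 + real CARD('m)"
  have q: "q \<ge> 1" by (simp add: q_def)
  define H where "H = {j. j < k \<and> hits (Suc j) W}"
  define h where "h = card H"
  define e' where "e' = 3 ^ h * (2/3) ^ k * e"
  have e': "e' > 0" using e by (simp add: e'_def)
  have mW: "W \<in> lmeasurable" using W by (intro lmeasurable_open_subset_cube)
  have mWE: "W - E \<in> lmeasurable" using W E by (intro lmeasurable_open_subset_cube open_Diff) auto
  have cell: "vol (W \<inter> cell t) \<le> a * q ^ h * vol (inner_bd (2/3 * e') (W \<inter> cell t))
    + b * vol (W \<inter> cell t) + d * vol ((W - E) \<inter> cell t)" for t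
  proof -
    define U where "U = branch t ` (W \<inter> cell t)"
    have UT: "U = T ` (W \<inter> cell t)" unfolding U_def by (intro image_cong) (auto simp: T_eq_branch)
    have U: "open U" "U \<subseteq> unit_cube"
      unfolding U_def using W open_cell by (intro open_branch_image open_Int)
        (use W T_cube in \<open>auto simp: UT U_def[symmetric]\<close>)
    have it: "(T ^^ j) (T x) = (T ^^ Suc j) x" for j x by (simp add: funpow_swap1)
    have nar: "narrow k U"
      using W(3) unfolding narrow_def UT by (auto simp: it simp del: funpow.simps)
    define hU where "hU = card {j. j < k \<and> hits j U}"
    have sub: "{j. j < k \<and> hits j U} \<subseteq> H"
      unfolding H_def hits_def UT by (auto simp: it simp del: funpow.simps)
    have hU: "hU \<le> h" unfolding hU_def h_def by (rule card_mono[OF _ sub]) (simp add: H_def)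
    have mI: "inner_bd r U \<in> lmeasurable" for r using U by (rule lmeasurable_inner_bd)
    have "vol U \<le> a * q ^ hU * vol (inner_bd (3 ^ hU * (2/3) ^ k * e) U) + b * vol U + d * vol (U - E)"
      using Suc.IH[OF U nar] by (simp add: hU_def q_def)
    moreover have "a * q ^ hU * vol (inner_bd (3 ^ hU * (2/3) ^ k * e) U) \<le> a * q ^ h * vol (inner_bd e' U)"
    proof (rule mult_mono)
      show "a * q ^ hU \<le> a * q ^ h" using a q hU by (intro mult_left_mono power_increasing) auto
      have "3 ^ hU * (2/3) ^ k * e \<le> e'"
        unfolding e'_def using e hU by (intro mult_right_mono power_increasing) auto
      then show "vol (inner_bd (3 ^ hU * (2/3) ^ k * e) U) \<le> vol (inner_bd e' U)"
        using mI by (intro vol_mono inner_bd_mono)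
    qed (use a q in auto)
    ultimately have IH: "vol U \<le> a * q ^ h * vol (inner_bd e' U) + b * vol U + d * vol (U - E)"
      by linarith
    obtain D where D: "D > 0" "\<And>X. X \<in> lmeasurable \<Longrightarrow> branch t ` X \<in> lmeasurable"
      "\<And>X. X \<in> lmeasurable \<Longrightarrow> vol (branch t ` X) = D * vol X"
      using vol_branch_image[of t] by blast
    have m1: "W \<inter> cell t \<in> lmeasurable" using mW open_cell by (rule lmeasurable_Int_open)
    have m2: "inner_bd (2/3 * e') (W \<inter> cell t) \<in> lmeasurable"
      using W open_cell by (intro lmeasurable_inner_bd open_Int) auto
    have m3: "(W - E) \<inter> cell t \<in> lmeasurable" using mWE open_cell by (rule lmeasurable_Int_open)
    have v1: "vol U = D * vol (W \<inter> cell t)" unfolding U_def using m1 by (rule D)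
    have v2: "vol (inner_bd e' U) \<le> D * vol (inner_bd (2/3 * e') (W \<inter> cell t))"
      using vol_mono[OF inner_bd_branch[of e' t "W \<inter> cell t"]] mI D(2)[OF m2] D(3)[OF m2] by (simp add: U_def)
    \<comment> \<open>Forward invariance of \<open>E\<close>: a point whose image is outside
      \<open>E\<close> is itself outside \<open>E\<close>.\<close>
    have "U - E \<subseteq> branch t ` ((W - E) \<inter> cell t)"
      using E(2) unfolding U_def by (force simp: T_eq_branch[symmetric])
    moreover have "U - E \<in> lmeasurable" using U E by (intro lmeasurable_open_subset_cube open_Diff) auto
    ultimately have v3: "vol (U - E) \<le> D * vol ((W - E) \<inter> cell t)"
      using vol_mono[of "U - E" "branch t ` ((W - E) \<inter> cell t)"] D(2)[OF m3] D(3)[OF m3] by simp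
    have "D * vol (W \<inter> cell t) \<le> a * q ^ h * (D * vol (inner_bd (2/3 * e') (W \<inter> cell t)))
        + b * (D * vol (W \<inter> cell t)) + d * (D * vol ((W - E) \<inter> cell t))"
      using IH unfolding v1
      by (rule order_trans) (intro add_mono mult_left_mono v2 v3 order_refl, use a q b d in auto)
    also have "\<dots> = D * (a * q ^ h * vol (inner_bd (2/3 * e') (W \<inter> cell t))
        + b * vol (W \<inter> cell t) + d * vol ((W - E) \<inter> cell t))"
      by (simp add: algebra_simps)
    finally show ?thesis using D(1) by simp
  qed
  define c where "c = card {j. j < Suc k \<and> hits j W}"
  \<comment> \<open>Hits of the images at time \<open>j\<close> are hits of \<open>W\<close> at time
    \<open>j + 1\<close>; only time 0 is new, and it decides whether the present cut is
    charged.\<close>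
  have split: "{j. j < Suc k \<and> hits j W} = (if hits 0 W then {0} else {}) \<union> Suc ` H"
    by (auto simp: H_def image_iff less_Suc_eq_0_disj)
  have cH: "card (Suc ` H) = h" by (simp add: card_image h_def)
  have e'': "2/3 * e' = 3 ^ h * (2/3) ^ Suc k * e" by (simp add: e'_def)
  have bd: "q ^ h * (\<Sum>t\<in>UNIV. vol (inner_bd (2/3 * e') (W \<inter> cell t)))
      \<le> q ^ c * vol (inner_bd (3 ^ c * (2/3) ^ Suc k * e) W)"
  proof (cases "hits 0 W")
    case True
    have "finite H" by (simp add: H_def)
    then have c: "c = Suc h" unfolding c_def split using True cH by simp
    have "(\<Sum>t\<in>UNIV. vol (inner_bd (2/3 * e') (W \<inter> cell t))) \<le> q * vol (inner_bd (3 * (2/3 * e')) W)"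
      unfolding q_def using W e' by (intro sum_inner_bd_cells_le) auto
    also have "3 * (2/3 * e') = 3 ^ c * (2/3) ^ Suc k * e" by (simp add: c e'_def)
    finally show ?thesis unfolding c using q by (simp add: mult.assoc mult_left_mono)
  next
    case False
    then have c: "c = h" unfolding c_def split using cH by simp
    have "(\<Sum>t\<in>UNIV. vol (inner_bd (2/3 * e') (W \<inter> cell t))) \<le> vol (inner_bd (2/3 * e') W)"
    proof (rule sum_inner_bd_cells_le_uncut[where d=\<delta>])
      show "\<bar>x $ i - y $ i\<bar> \<le> \<delta>" if "x \<in> W" "y \<in> W" for x y i
        using W(3) that unfolding narrow_def by (metis eq_id_iff funpow_0 id_apply zero_less_Suc)
      show "\<delta> < \<bar>x $ i - 1/2\<bar>" if "x \<in> W" for x i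
        using False that unfolding hits_def by (metis funpow_0 not_le)
    qed (use W in auto)
    then show ?thesis unfolding c e'' using q by (intro mult_left_mono) auto
  qed
  have "vol W = (\<Sum>t\<in>UNIV. vol (W \<inter> cell t))" using mW by (rule vol_eq_sum_cells)
  also have "\<dots> \<le> (\<Sum>t\<in>UNIV. a * q ^ h * vol (inner_bd (2/3 * e') (W \<inter> cell t))
    + b * vol (W \<inter> cell t) + d * vol ((W - E) \<inter> cell t))"
    using cell by (intro sum_mono)
  also have "\<dots> = a * (q ^ h * (\<Sum>t\<in>UNIV. vol (inner_bd (2/3 * e') (W \<inter> cell t))))
    + b * vol W + d * vol (W - E)"
    using vol_eq_sum_cells[OF mW] vol_eq_sum_cells[OF mWE]
    by (simp add: sum.distrib sum_distrib_left mult.assoc)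
  also have "\<dots> \<le> a * (q ^ c * vol (inner_bd (3 ^ c * (2/3) ^ Suc k * e) W)) + b * vol W + d * vol (W - E)"
    using bd a by (intro add_right_mono mult_left_mono)
  finally show ?case by (simp add: q_def c_def mult.assoc)
qed

end

section \<open>Iterating the volume bound in blocks of \<open>K\<close> steps\<close>

lemma volume_bound_mono:
  assumes "volume_bound E e a b d" "b \<le> b'"
  shows "volume_bound E e a b' d"
  unfolding volume_bound_def
proof (intro allI impI)
  fix W :: "(real^'a) set" assume "open W \<and> W \<subseteq> unit_cube"
  moreover have "b * vol W \<le> b' * vol W" using assms(2) by (intro mult_right_mono) auto
  ultimately show "vol W \<le> a * vol (inner_bd e W) + b' * vol W + d * vol (W - E)"
    using assms(1) unfolding volume_bound_def by fastforce
qed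

lemma vol_unit_cube: "vol (unit_cube :: (real^'m) set) = 1"
proof -
  have "cbox (0::real^'m) (\<chi> i. 1) \<noteq> {}" by (auto simp: interval_ne_empty_cart)
  then show ?thesis unfolding unit_cube_eq_cbox by (simp add: content_cbox_cart)
qed

text \<open>Either \<open>W\<close> contains a ball of radius \<open>e\<close>, and then
  \<open>vol W \<le> 1 \<le> vol (W - E) / \<kappa>\<close>, or it contains none and is its own
  collar.\<close>

lemma volume_bound_base:
  fixes E :: "(real^'m) set"
  assumes \<kappa>: "\<kappa> > 0" and E: "closed E"
    and escape: "\<And>y. ball y e \<subseteq> unit_cube \<Longrightarrow> \<kappa> \<le> vol (ball y e - E)"
  shows "volume_bound E e 1 0 (1 / \<kappa>)"
  unfolding volume_bound_def
proof (intro allI impI)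
  fix W :: "(real^'m) set" assume W: "open W \<and> W \<subseteq> unit_cube"
  then have mW: "W \<in> lmeasurable" by (intro lmeasurable_open_subset_cube) auto
  show "vol W \<le> 1 * vol (inner_bd e W) + 0 * vol W + 1 / \<kappa> * vol (W - E)"
  proof (cases "\<exists>y. ball y e \<subseteq> W")
    case True
    then obtain y where y: "ball y e \<subseteq> W" by blast
    then have "\<kappa> \<le> vol (ball y e - E)" using W by (intro escape) auto
    also have "\<dots> \<le> vol (W - E)"
      using W y E by (intro vol_mono lmeasurable_open_subset_cube open_Diff) auto
    finally have "1 \<le> 1 / \<kappa> * vol (W - E)" using \<kappa> by (simp add: field_simps)
    moreover have "vol W \<le> vol (unit_cube :: (real^'m) set)"
      using W mW by (intro vol_mono) (auto simp: unit_cube_eq_cbox)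
    moreover have "0 \<le> vol (inner_bd e W)" by simp
    ultimately show ?thesis unfolding vol_unit_cube by linarith
  next
    case False
    then have "inner_bd e W = W" by (force simp: inner_bd_def subset_eq)
    then show ?thesis using \<kappa> by simp
  qed
qed

text \<open>Effect of a block of \<open>K\<close> steps with \<open>m\<close> hits:
  \<open>growth\<close> multiplies the collar volume and \<open>shrink\<close> the collar
  width.\<close>

abbreviation growth :: "nat \<Rightarrow> real" where
  "growth m \<equiv> (1 + real m) ^ m"

abbreviation shrink :: "nat \<Rightarrow> nat \<Rightarrow> real" where
  "shrink m K \<equiv> 3 ^ m * (2/3) ^ K"

text \<open>Pieces with sides this short have diameter at most
  \<open>1 / (64 * 2 ^ K) / 3 ^ K\<close>, and \<open>T\<close> stretches distances at most by 3; so
  they stay narrow for \<open>K\<close> steps.\<close>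

abbreviation mesh :: "nat \<Rightarrow> nat \<Rightarrow> real" where
  "mesh m K \<equiv> 1 / (64 * 2 ^ K) / (real m * 3 ^ K)"

text \<open>The initial collar width. Its denominator makes the slicing cost of each round a quarter
  of a power of \<open>growth * shrink\<close>. It depends on \<open>m\<close> and \<open>K\<close>
  but not on the coupling.\<close>

abbreviation scale :: "nat \<Rightarrow> nat \<Rightarrow> real" where
  "scale m K \<equiv> mesh m K / (16 * real m)"

context small_coupling
begin

lemma narrow_of_mesh:
  fixes V :: "(real^'m) set"
  assumes "\<And>x y i. x \<in> V \<Longrightarrow> y \<in> V \<Longrightarrow> \<bar>x $ i - y $ i\<bar> \<le> mesh CARD('m) K"
  shows "narrow K V"
  unfolding narrow_def
proof (intro allI impI ballI)
  fix j x y i assume j: "j < K" and xy: "x \<in> V" "y \<in> V"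
  have "dist x y \<le> real CARD('m) * mesh CARD('m) K"
    using assms xy by (intro dist_le_of_components)
  then have d: "dist x y \<le> \<delta> / 3 ^ K" by simp
  have "\<bar>(T ^^ j) x $ i - (T ^^ j) y $ i\<bar> \<le> 3 ^ j * dist x y"
    using abs_component_diff_le dist_T_funpow by (rule order_trans)
  also have "\<dots> \<le> 3 ^ K * (\<delta> / 3 ^ K)"
    using d j by (intro mult_mono power_increasing) auto
  finally show "\<bar>(T ^^ j) x $ i - (T ^^ j) y $ i\<bar> \<le> \<delta>" by simp
qed

text \<open>One round: slicing to the mesh makes the pieces narrow, so at most
  \<open>CARD('m)\<close> hits occur in \<open>K\<close> steps. The slicing is paid for in the third
  parameter.\<close>

lemma volume_bound_renewal:
  assumes vb: "volume_bound E e a b d" and a: "a \<ge> 0" and b: "b \<ge> 0" and d: "d \<ge> 0" and e: "e > 0"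
    and E: "closed E" "\<And>x. x \<in> E \<Longrightarrow> T x \<in> E"
  shows "volume_bound E (shrink CARD('m) K * e) (growth CARD('m) * a)
    (b + real CARD('m) * (growth CARD('m) * a * (4 / mesh CARD('m) K * (shrink CARD('m) K * e)))) d"
  unfolding volume_bound_def
proof (intro allI impI)
  fix W :: "(real^'m) set" assume W: "open W \<and> W \<subseteq> unit_cube"
  have slice: "vol V \<le> growth CARD('m) * a * vol (inner_bd (shrink CARD('m) K * e) V) + b * vol V + d * vol (V - E)"
    if V: "open V" "V \<subseteq> unit_cube" "\<And>x y i. x \<in> V \<Longrightarrow> y \<in> V \<Longrightarrow> i \<in> UNIV \<Longrightarrow> \<bar>x $ i - y $ i\<bar> \<le> mesh CARD('m) K" for V
  proof -
    have nar: "narrow K V" using V(3) by (intro narrow_of_mesh) auto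
    define h where "h = card {j. j < K \<and> hits j V}"
    have h: "h \<le> CARD('m)" unfolding h_def using V nar by (intro card_hits_le)
    have "vol V \<le> a * (1 + real CARD('m)) ^ h * vol (inner_bd (3 ^ h * (2/3) ^ K * e) V)
        + b * vol V + d * vol (V - E)"
      unfolding h_def by (rule volume_bound_pull_back[OF vb a b d e E V(1,2) nar])
    moreover have "a * (1 + real CARD('m)) ^ h * vol (inner_bd (3 ^ h * (2/3) ^ K * e) V)
        \<le> growth CARD('m) * a * vol (inner_bd (shrink CARD('m) K * e) V)"
    proof (rule mult_mono)
      show "a * (1 + real CARD('m)) ^ h \<le> growth CARD('m) * a"
        unfolding mult.commute[of "growth CARD('m)"] using a h by (intro mult_left_mono power_increasing) auto
      have "3 ^ h * (2/3) ^ K * e \<le> shrink CARD('m) K * e"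
        using h e by (intro mult_right_mono power_increasing) auto
      then show "vol (inner_bd (3 ^ h * (2/3) ^ K * e) V) \<le> vol (inner_bd (shrink CARD('m) K * e) V)"
        using V by (intro vol_mono inner_bd_mono lmeasurable_inner_bd)
    qed (use a in auto)
    ultimately show ?thesis by linarith
  qed
  show "vol W \<le> growth CARD('m) * a * vol (inner_bd (shrink CARD('m) K * e) W)
      + (b + real CARD('m) * (growth CARD('m) * a * (4 / mesh CARD('m) K * (shrink CARD('m) K * e)))) * vol W + d * vol (W - E)"
    by (rule volume_bound_slice_all[where S=UNIV, OF E(1) _ _ _ finite]) (use slice W a e in auto)
qed

text \<open>Since expansion beats cutting, which is assumption \<open>K\<close>, the slicing costs
  are dominated by a geometric series and their sum stays below 1/4.\<close>

lemma volume_bound_iterate: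
  assumes K: "growth CARD('m) * shrink CARD('m) K \<le> 1/2" and vb: "volume_bound E (scale CARD('m) K) 1 0 d" and d: "d \<ge> 0"
    and E: "closed E" "\<And>x. x \<in> E \<Longrightarrow> T x \<in> E"
  shows "volume_bound E (shrink CARD('m) K ^ n * scale CARD('m) K) (growth CARD('m) ^ n) ((1 - (1/2) ^ n) / 4) d"
proof (induction n)
  case 0
  then show ?case using vb by simp
next
  case (Suc n)
  have s: "shrink CARD('m) K > 0" "mesh CARD('m) K > 0" "scale CARD('m) K > 0" "growth CARD('m) > 0" by simp_all
  have eq: "real CARD('m) * (g * gn * (4 / w * (t * (tn * (w / (16 * real CARD('m))))))) = (g * gn * (t * tn)) / 4"
    if "w > 0" for g gn w t tn :: real
    using that by (simp add: field_simps)
  have "volume_bound E (shrink CARD('m) K * (shrink CARD('m) K ^ n * scale CARD('m) K)) (growth CARD('m) * growth CARD('m) ^ n)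
    ((1 - (1/2) ^ n) / 4 + real CARD('m) * (growth CARD('m) * growth CARD('m) ^ n * (4 / mesh CARD('m) K * (shrink CARD('m) K * (shrink CARD('m) K ^ n * scale CARD('m) K))))) d"
    by (rule volume_bound_renewal[OF Suc _ _ d _ E]) (use s in \<open>simp_all add: power_le_one\<close>)
  then have "volume_bound E (shrink CARD('m) K ^ Suc n * scale CARD('m) K) (growth CARD('m) ^ Suc n)
    ((1 - (1/2) ^ n) / 4 + (growth CARD('m) * growth CARD('m) ^ n * (shrink CARD('m) K * shrink CARD('m) K ^ n)) / 4) d"
    unfolding eq[OF s(2)] by (simp only: power_Suc mult.assoc)
  moreover have "(1 - (1/2) ^ n) / 4 + (growth CARD('m) * growth CARD('m) ^ n * (shrink CARD('m) K * shrink CARD('m) K ^ n)) / 4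
      \<le> (1 - (1/2) ^ Suc n) / 4"
  proof -
    have "growth CARD('m) * growth CARD('m) ^ n * (shrink CARD('m) K * shrink CARD('m) K ^ n) =
        (growth CARD('m) * shrink CARD('m) K) ^ Suc n"
      by (simp only: power_mult_distrib power_Suc mult_ac)
    also have "\<dots> \<le> (1/2) ^ Suc n"
      using K s by (intro power_mono) auto
    finally have "growth CARD('m) * growth CARD('m) ^ n * (shrink CARD('m) K * shrink CARD('m) K ^ n) \<le> 1/2 * (1/2) ^ n"
      by simp
    moreover have "(1 - p) / 4 + X / 4 \<le> (1 - 1/2 * p) / 4" if "X \<le> 1/2 * p" for X p :: real
      using that by (simp add: field_simps)
    ultimately show ?thesis unfolding power_Suc by blast
  qed
  ultimately show ?case by (rule volume_bound_mono)
qed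

text \<open>An invariant set of positive measure fills some box almost completely; the pieces into which
  the iterates of that box are cut are mostly large, hence contain balls, and one of them would be
  nearly filled.\<close>

lemma invariant_negligible:
  assumes K: "growth CARD('m) * shrink CARD('m) K \<le> 1/2"
    and E: "closed E" "E \<subseteq> unit_cube" "\<And>x. x \<in> E \<Longrightarrow> T x \<in> E"
    and \<kappa>: "\<kappa> > 0" and escape: "\<And>y. ball y (scale CARD('m) K) \<subseteq> unit_cube \<Longrightarrow> \<kappa> \<le> vol (ball y (scale CARD('m) K) - E)"
  shows "negligible E"
proof (rule ccontr)
  assume "\<not> negligible E"
  \<comment> \<open>The fraction \<open>\<kappa> / 4\<close> bounds the escape term by a quarter of
    the volume of the box. Slicing takes at most another quarter, so the collar term must supply the
    remaining half, yet it tends to 0.\<close>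
  then obtain u v where uv: "box u v \<subseteq> unit_cube" "box u v \<noteq> {}"
    "vol (box u v - E) \<le> \<kappa> / 4 * vol (box u v)"
    using dense_box_exists[OF E(1,2), of "\<kappa> / 4"] \<kappa> by auto
  define B where "B = box u v"
  have mB: "B \<in> lmeasurable" by (simp add: B_def)
  have "\<not> negligible B" using uv(2) open_not_negligible by (auto simp: B_def)
  then have posB: "vol B > 0" using mB negligible_iff_measure by (metis measure_nonneg order_le_less)
  have base: "volume_bound E (scale CARD('m) K) 1 0 (1 / \<kappa>)" using \<kappa> E(1) escape by (rule volume_bound_base)
  have le: "vol B / 2 \<le> 4 * real CARD('m) * scale CARD('m) K * (1/2) ^ n" for n
  proof -
    have sc: "shrink CARD('m) K ^ n * scale CARD('m) K > 0" by simp
    have vb: "volume_bound E (shrink CARD('m) K ^ n * scale CARD('m) K) (growth CARD('m) ^ n)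
        ((1 - (1/2) ^ n) / 4) (1 / \<kappa>)"
      by (rule volume_bound_iterate[OF K base _ E(1,3)]) (use \<kappa> in simp)
    have "vol B \<le> growth CARD('m) ^ n * vol (inner_bd (shrink CARD('m) K ^ n * scale CARD('m) K) B) + (1 - (1/2) ^ n) / 4 * vol B
        + 1 / \<kappa> * vol (B - E)"
      by (rule vb[unfolded volume_bound_def, rule_format]) (use uv(1) in \<open>auto simp: B_def open_box\<close>)
    moreover have "(1 - (1/2) ^ n) / 4 * vol B \<le> 1/4 * vol B" by (intro mult_right_mono) auto
    moreover have "1 / \<kappa> * vol (B - E) \<le> 1 / \<kappa> * (\<kappa> / 4 * vol B)"
      using uv(3) \<kappa> unfolding B_def by (intro mult_left_mono) auto
    then have "1 / \<kappa> * vol (B - E) \<le> 1/4 * vol B" using \<kappa> by simp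
    moreover have "growth CARD('m) ^ n * vol (inner_bd (shrink CARD('m) K ^ n * scale CARD('m) K) B)
        \<le> growth CARD('m) ^ n * (4 * real CARD('m) * (shrink CARD('m) K ^ n * scale CARD('m) K))"
      unfolding B_def using uv(1) sc by (intro mult_left_mono vol_inner_bd_box_le) auto
    moreover have "growth CARD('m) ^ n * (4 * real CARD('m) * (shrink CARD('m) K ^ n * scale CARD('m) K)) =
        4 * real CARD('m) * scale CARD('m) K * (growth CARD('m) * shrink CARD('m) K) ^ n"
      by (simp only: power_mult_distrib mult_ac)
    moreover have "4 * real CARD('m) * scale CARD('m) K * (growth CARD('m) * shrink CARD('m) K) ^ n \<le> 4 * real CARD('m) * scale CARD('m) K * (1/2) ^ n"
      using K by (intro mult_left_mono power_mono) auto
    ultimately show ?thesis by linarith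
  qed
  have "(\<lambda>n. 4 * real CARD('m) * scale CARD('m) K * (1/2) ^ n) \<longlonglongrightarrow> 4 * real CARD('m) * scale CARD('m) K * 0"
    by (intro tendsto_mult_left LIMSEQ_power_zero) simp
  from LIMSEQ_le_const[OF this, of "vol B / 2"] le posB show False by auto
qed

end

section \<open>Visits to the diagonal\<close>

text \<open>Compose the inverse branches of the tent map that follow the itinerary of
  \<open>y\<close>. Each halves distances, so the values end up within \<open>1 / 2 ^ n\<close> of
  \<open>y\<close>.\<close>

lemma tent_inverse_branch:
  assumes "0 \<le> y" "y \<le> 1"
  shows "\<exists>g. continuous_on UNIV g \<and> (\<forall>s\<in>{0..1}. g s \<in> {0..1} \<and> (tent ^^ n) (g s) = s \<and> \<bar>g s - y\<bar> \<le> 1 / 2 ^ n)"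
  using assms
proof (induction n arbitrary: y)
  case 0
  then show ?case by (intro exI[of _ "\<lambda>s. s"]) auto
next
  case (Suc n)
  obtain g where g: "continuous_on UNIV g"
    "\<And>s. s \<in> {0..1} \<Longrightarrow> g s \<in> {0..1} \<and> (tent ^^ n) (g s) = s \<and> \<bar>g s - tent y\<bar> \<le> 1 / 2 ^ n"
    using Suc.IH[of "tent y"] tent_bounds[OF Suc.prems] by blast
  show ?case
  proof (cases "y \<le> 1/2")
    case True
    have "g s / 2 \<in> {0..1} \<and> (tent ^^ Suc n) (g s / 2) = s \<and> \<bar>g s / 2 - y\<bar> \<le> 1 / 2 ^ Suc n"
      if "s \<in> {0..1}" for s
    proof -
      have "tent (g s / 2) = g s" "tent y = 2 * y" using g(2)[OF that] True by (auto simp: tent_def)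
      then show ?thesis using g(2)[OF that] by (auto simp: funpow_Suc_right abs_le_iff field_simps simp del: funpow.simps)
    qed
    then show ?thesis using g(1) by (intro exI[of _ "\<lambda>s. g s / 2"]) (auto intro!: continuous_intros simp del: funpow.simps)
  next
    case False
    have "1 - g s / 2 \<in> {0..1} \<and> (tent ^^ Suc n) (1 - g s / 2) = s \<and> \<bar>1 - g s / 2 - y\<bar> \<le> 1 / 2 ^ Suc n"
      if "s \<in> {0..1}" for s
    proof -
      have 1: "tent (1 - g s / 2) = g s" and 2: "tent y = 2 - 2 * y"
        using g(2)[OF that] False by (auto simp: tent_def)
      show ?thesis using 1 g(2)[OF that, unfolded 2] by (auto simp: funpow_Suc_right abs_le_iff field_simps simp del: funpow.simps)
    qed
    then show ?thesis using g(1) by (intro exI[of _ "\<lambda>s. 1 - g s / 2"]) (auto intro!: continuous_intros simp del: funpow.simps)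
  qed
qed

context small_coupling
begin

lemma T_funpow_component:
  assumes "x \<in> unit_cube"
  shows "\<bar>(T ^^ n) x $ i - (tent ^^ n) (x $ i)\<bar> \<le> (2 ^ n - 1) * \<delta>"
proof (induction n)
  case (Suc n)
  have 1: "\<bar>(T ^^ Suc n) x $ i - tent ((T ^^ n) x $ i)\<bar> \<le> \<delta>"
    using T_component[OF T_funpow_cube[OF assms], of n i] by simp
  have 2: "\<bar>tent ((T ^^ n) x $ i) - (tent ^^ Suc n) (x $ i)\<bar> \<le> 2 * \<bar>(T ^^ n) x $ i - (tent ^^ n) (x $ i)\<bar>"
    using tent_lipschitz by simp
  have "\<bar>u - w\<bar> \<le> (2 * p - 1) * d" if "\<bar>u - v\<bar> \<le> d" "\<bar>v - w\<bar> \<le> 2 * e" "e \<le> (p - 1) * d"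
    for u v w d e p :: real
    using that by (simp add: algebra_simps)
  from this[OF 1 2 Suc] show ?case unfolding power_Suc .
qed simp

text \<open>\<open>T ^^ K\<close> is uniformly close to the uncoupled map, which maps a dyadic cube near \<open>y\<close> affinely
  onto the unit cube; Brouwer's theorem then produces a preimage of the centre.\<close>

lemma reach_centre:
  assumes y: "y \<in> unit_cube"
  obtains z where "z \<in> unit_cube" "\<And>i. \<bar>z $ i - y $ i\<bar> \<le> 1 / 2 ^ K" "(T ^^ K) z = (\<chi> i. 1/2)"
proof -
  have "\<forall>i. \<exists>g. continuous_on UNIV g \<and>
      (\<forall>s\<in>{0..1}. g s \<in> {0..1} \<and> (tent ^^ K) (g s) = s \<and> \<bar>g s - y $ i\<bar> \<le> 1 / 2 ^ K)"
    using y by (intro allI tent_inverse_branch) (auto simp: unit_cube_def)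
  then obtain g where g: "\<And>i. continuous_on UNIV (g i)"
    "\<And>i s. s \<in> {0..1} \<Longrightarrow> g i s \<in> {0..1} \<and> (tent ^^ K) (g i s) = s \<and> \<bar>g i s - y $ i\<bar> \<le> 1 / 2 ^ K"
    by metis
  define G :: "real^'m \<Rightarrow> real^'m" where "G s = (\<chi> i. g i (s $ i))" for s
  have G: "G s \<in> unit_cube" if "s \<in> unit_cube" for s
    using that g(2) by (auto simp: G_def unit_cube_def)
  have contG: "continuous_on S G" for S
  proof -
    have "continuous_on S (\<lambda>s. g i (s $ i))" for i
      by (rule continuous_on_compose2[OF g(1)]) (auto intro!: continuous_intros)
    then show ?thesis unfolding G_def[abs_def] by (intro continuous_on_vec_lambda)
  qed
  define p :: "real^'m" where "p = (\<chi> i. 1/2)"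
  \<comment> \<open>A fixed point of \<open>F\<close> is an \<open>s\<close> with
    \<open>(T ^^ K) (G s) = p\<close>. As \<open>(T ^^ K) (G s)\<close> is within 1/2 of
    \<open>s\<close> in each coordinate, \<open>F s\<close> is within 1/2 of the centre
    \<open>p\<close>, hence in the cube.\<close>
  define F where "F s = s - (T ^^ K) (G s) + p" for s
  have "F s \<in> unit_cube" if s: "s \<in> unit_cube" for s
  proof -
    have "0 \<le> F s $ i \<and> F s $ i \<le> 1" for i
    proof -
      have "s $ i \<in> {0..1}" using s by (simp add: unit_cube_def)
      then have "(tent ^^ K) (G s $ i) = s $ i" using g(2) by (simp add: G_def)
      moreover have "(2 ^ K - 1) * \<delta> \<le> 1/2" by (simp add: field_simps)
      ultimately have "\<bar>(T ^^ K) (G s) $ i - s $ i\<bar> \<le> 1/2"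
        using T_funpow_component[OF G[OF s], of K i] by linarith
      moreover have "F s $ i = s $ i - (T ^^ K) (G s) $ i + 1/2" by (simp add: F_def p_def)
      ultimately show ?thesis unfolding abs_le_iff by linarith
    qed
    then show ?thesis by (simp add: unit_cube_def)
  qed
  moreover have "continuous_on unit_cube F"
    unfolding F_def[abs_def]
    by (intro continuous_intros continuous_on_compose2[OF continuous_T_funpow[of UNIV] contG]) auto
  ultimately obtain s where s: "s \<in> unit_cube" "F s = s"
    using brouwer[of "unit_cube" F] y by (auto simp: unit_cube_eq_cbox convex_box)
  have "(T ^^ K) (G s) = p" using s(2) by (simp add: F_def algebra_simps)
  moreover have "\<bar>G s $ i - y $ i\<bar> \<le> 1 / 2 ^ K" for i
    using s(1) g(2)[of "s $ i" i] by (simp add: G_def unit_cube_def)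
  ultimately show thesis using that[of "G s"] G[OF s(1)] by (simp add: p_def)
qed

lemma closed_orbit_condition:
  assumes "closed S" "continuous_on UNIV f"
  shows "closed {x \<in> unit_cube. \<forall>n. f ((T ^^ n) x) \<in> S}"
proof -
  have "closed ((\<lambda>x. f ((T ^^ n) x)) -` S)" for n
    by (intro closed_vimage assms continuous_on_compose2[OF assms(2) continuous_T_funpow]) auto
  then have "closed (unit_cube \<inter> (\<Inter>n. (\<lambda>x. f ((T ^^ n) x)) -` S))"
    by (intro closed_Int closed_INT) (auto simp: unit_cube_eq_cbox)
  moreover have "unit_cube \<inter> (\<Inter>n. (\<lambda>x. f ((T ^^ n) x)) -` S) = {x \<in> unit_cube. \<forall>n. f ((T ^^ n) x) \<in> S}"
    by auto
  ultimately show ?thesis by simp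
qed

lemma orbit_condition_invariant:
  assumes "x \<in> {x \<in> unit_cube. \<forall>n. f ((T ^^ n) x) \<in> S}"
  shows "T x \<in> {x \<in> unit_cube. \<forall>n. f ((T ^^ n) x) \<in> S}"
proof -
  have "(T ^^ n) (T x) = (T ^^ Suc n) x" for n by (simp add: funpow_swap1)
  then show ?thesis using assms T_cube by (auto simp del: funpow.simps)
qed

text \<open>If the conclusion fails, some tail of the orbit stays at distance at least some
  \<open>r > 0\<close> or at most \<open>\<gamma>\<close>. The starting point then lies in an
  iterated preimage of a null set; taking \<open>r\<close> among reciprocals of positive integers
  leaves countably many of these.\<close>

lemma AE_liminf_limsup:
  assumes near: "\<And>r. r > 0 \<Longrightarrow> negligible {x \<in> unit_cube. \<forall>n. infdist ((T ^^ n) x) D_syn \<in> {r..}}"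
    and far: "negligible {x \<in> unit_cube. \<forall>n. infdist ((T ^^ n) x) D_syn \<in> {..\<gamma>}}"
  shows "AE x in lebesgue. x \<in> unit_cube \<longrightarrow>
    liminf (\<lambda>n. ereal (infdist ((T ^^ n) x) D_syn)) = 0 \<and>
    limsup (\<lambda>n. ereal (infdist ((T ^^ n) x) D_syn)) \<ge> ereal \<gamma>"
proof -
  define P where "P = (\<lambda>r. {x \<in> unit_cube. \<forall>n. infdist ((T ^^ n) x) D_syn \<in> {r..}})"
  define Q where "Q = {x \<in> unit_cube. \<forall>n. infdist ((T ^^ n) x) D_syn \<in> {..\<gamma>}}"
  define Bad where "Bad = (\<Union>N. \<Union>j::nat. {x. (T ^^ N) x \<in> P (inverse (real (Suc j)))}) \<union> (\<Union>N. {x. (T ^^ N) x \<in> Q})"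
  have nP: "negligible {x. (T ^^ N) x \<in> P (inverse (real (Suc j)))}" for N j
    unfolding P_def by (intro negligible_vimage_T_funpow near) simp
  have nQ: "negligible {x. (T ^^ N) x \<in> Q}" for N
    unfolding Q_def by (intro negligible_vimage_T_funpow far)
  have "negligible Bad"
    unfolding Bad_def by (intro negligible_Un negligible_Union_nat nP nQ)
  then have "AE x in lebesgue. x \<notin> Bad"
    by (intro AE_not_in) (simp add: negligible_iff_null_sets)
  then show ?thesis
  proof (rule eventually_mono, intro impI conjI)
    fix x assume x: "x \<notin> Bad" "x \<in> unit_cube"
    let ?f = "\<lambda>n. ereal (infdist ((T ^^ n) x) D_syn)"
    have shift: "(T ^^ n) ((T ^^ N) x) = (T ^^ (n + N)) x" for n N by (simp add: funpow_add)
    have "liminf ?f \<ge> 0"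
      by (intro Liminf_bounded always_eventually) (simp add: infdist_nonneg)
    moreover have "\<not> 0 < liminf ?f"
    proof
      assume "0 < liminf ?f"
      then obtain r where r: "0 < ereal r" "ereal r < liminf ?f" using ereal_dense2 by blast
      then obtain N where N: "\<And>n. n \<ge> N \<Longrightarrow> ereal r < ?f n"
        using less_LiminfD[OF r(2)] unfolding eventually_sequentially by blast
      obtain j where j: "inverse (real (Suc j)) < r" using reals_Archimedean r(1) by auto
      have "infdist ((T ^^ n) ((T ^^ N) x)) D_syn \<ge> inverse (real (Suc j))" for n
        using N[of "n + N"] j unfolding shift by simp
      then have "(T ^^ N) x \<in> P (inverse (real (Suc j)))"
        using T_funpow_cube[OF x(2)] by (simp add: P_def)
      then show False using x(1) unfolding Bad_def by blast
    qed
    ultimately show "liminf ?f = 0" by (meson not_le order_antisym)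
    show "limsup ?f \<ge> ereal \<gamma>"
    proof (rule ccontr)
      assume "\<not> ?thesis"
      then have "limsup ?f < ereal \<gamma>" by simp
      then obtain N where N: "\<And>n. n \<ge> N \<Longrightarrow> ?f n < ereal \<gamma>"
        using Limsup_lessD[OF \<open>limsup ?f < ereal \<gamma>\<close>] unfolding eventually_sequentially by blast
      have "infdist ((T ^^ n) ((T ^^ N) x)) D_syn \<le> \<gamma>" for n
        using N[of "n + N"] unfolding shift by simp
      then have "(T ^^ N) x \<in> Q" using T_funpow_cube[OF x(2)] by (simp add: Q_def)
      then show False using x(1) unfolding Bad_def by blast
    qed
  qed
qed

end

section \<open>Escaping balls and the choice of constants\<close>

lemma vol_ball_diff_ge:
  fixes z y :: "real^'m"
  assumes "ball z r \<subseteq> ball y s" "\<And>x. x \<in> ball z r \<Longrightarrow> x \<notin> E" "closed E" "r > 0"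
  shows "vol (ball (0::real^'m) r) \<le> vol (ball y s - E)"
proof -
  have "vol (ball (0::real^'m) r) = vol (ball z r)" using assms by (simp add: content_ball)
  also have "\<dots> \<le> vol (ball y s - E)"
    using assms by (intro vol_mono lmeasurable_open open_Diff) (auto intro: bounded_subset[OF bounded_ball])
  finally show ?thesis .
qed

text \<open>A diagonal point has equal coordinates, so it misses \<open>x $ i\<close> or
  \<open>x $ j\<close> by at least half their difference.\<close>

lemma D_syn_infdist_ge:
  fixes x :: "real^'m"
  shows "\<bar>x $ i - x $ j\<bar> / 2 \<le> infdist x D_syn"
proof -
  have "0 \<in> (D_syn :: (real^'m) set)" by (simp add: D_syn_def unit_cube_def)
  moreover have "\<bar>x $ i - x $ j\<bar> / 2 \<le> dist x d" if "d \<in> D_syn" for d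
  proof -
    have "d $ i = d $ j" using that by (simp add: D_syn_def)
    then have "\<bar>x $ i - x $ j\<bar> \<le> \<bar>x $ i - d $ i\<bar> + \<bar>x $ j - d $ j\<bar>" by simp
    with abs_component_diff_le[of x i d] abs_component_diff_le[of x j d] show ?thesis by simp
  qed
  ultimately show ?thesis using cINF_greatest[of D_syn _ "dist x"]
    by (metis empty_iff infdist_notempty)
qed

lemma vol_ball_pos:
  assumes "r > 0"
  shows "0 < vol (ball (0::real^'m) r)"
  using assms by (simp add: content_ball unit_ball_vol_pos)

lemma small_coupling_exists:
  fixes A :: "real^'m^'m"
  obtains c_plus where "c_plus > 0"
    "\<And>c. \<lbrakk>0 \<le> c; c < c_plus; \<forall>x\<in>unit_cube. coupling c A *v x \<in> unit_cube\<rbrakk> \<Longrightarrow> small_coupling A c K"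
proof -
  obtain a where a: "a > 0" "\<And>v. norm (A *v v) \<le> norm v * a"
    using bounded_linear.pos_bounded[OF matrix_vector_mul_bounded_linear[of A]] by blast
  define M where "M = 64 * 2 ^ K * real CARD('m)"
  have "(1::real) \<le> 2 ^ K * real CARD('m)"
    using mult_mono[of 1 "2 ^ K" 1 "real CARD('m)"] by (simp add: Suc_leI)
  then have M: "4 \<le> M" unfolding M_def mult.assoc by linarith
  show thesis
  proof (rule that[of "1 / (a * M)"])
    show "1 / (a * M) > 0" using a M by simp
    fix c assume c: "0 \<le> c" "c < 1 / (a * M)" "\<forall>x\<in>unit_cube. coupling c A *v x \<in> unit_cube"
    have ca: "c * a \<le> 1 / M" using c(2) a(1) M by (simp add: field_simps)
    have norm: "norm ((c *\<^sub>R A) *v v) \<le> norm v / M" for v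
    proof -
      have "norm ((c *\<^sub>R A) *v v) = c * norm (A *v v)"
        using c(1) by (simp add: scaleR_matrix_vector_assoc[symmetric])
      also have "\<dots> \<le> c * (norm v * a)" using c(1) a(2) by (intro mult_left_mono)
      also have "\<dots> = (c * a) * norm v" by simp
      also have "\<dots> \<le> 1 / M * norm v" using ca by (intro mult_right_mono) auto
      finally show ?thesis by simp
    qed
    show "small_coupling A c K"
    proof
      show "coupling c A *v x \<in> unit_cube" if "x \<in> unit_cube" for x using c(3) that by blast
      show "norm ((c *\<^sub>R A) *v v) \<le> norm v / 4" for v
      proof -
        have "norm v / M \<le> norm v / 4" using M by (intro divide_left_mono) auto
        with norm[of v] show ?thesis by linarith
      qed
      show "\<bar>((c *\<^sub>R A) *v x) $ i\<bar> \<le> 1 / (64 * 2 ^ K)" if "x \<in> unit_cube" for x i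
      proof -
        have "norm x \<le> real CARD('m) * 1"
          using dist_le_of_components[of x 0 1] that by (auto simp: unit_cube_def)
        then have "norm x / M \<le> real CARD('m) / M" using M by (intro divide_right_mono) auto
        also have "\<dots> = 1 / (64 * 2 ^ K)" by (simp add: M_def)
        finally show ?thesis
          using norm[of x] component_le_norm_cart[of "(c *\<^sub>R A) *v x" i] by linarith
      qed
    qed
  qed
qed

text \<open>Lets one threshold for \<open>c\<close> serve two time scales: one for the growth of
  pieces, one for reaching the centre.\<close>

lemma small_coupling_mono:
  assumes "small_coupling A c K" "K' \<le> K"
  shows "small_coupling A c K'"
proof -
  interpret small_coupling A c K by fact
  have "1 / (64 * 2 ^ K) \<le> 1 / (64 * 2 ^ K' :: real)"
    using assms(2) by (intro divide_left_mono mult_left_mono power_increasing) auto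
  then show ?thesis
    by unfold_locales (use cube norm_small order_trans[OF component_small] in blast)+
qed

theorem theorem1p3:
  fixes A :: "real ^ 'm ^ 'm"
  assumes "CARD('m) \<ge> 2"
    and "transpose A = A"
    and "A *v (\<chi> i. 1) = 0"
  shows "\<exists>c_plus>0. \<forall>c. 0 \<le> c \<and> c < c_plus \<and>
      (\<forall>x\<in>unit_cube. coupling c A *v x \<in> unit_cube) \<longrightarrow>
      (\<exists>\<gamma>\<^sub>0>0. AE x in lebesgue. x \<in> unit_cube \<longrightarrow>
        liminf (\<lambda>n. ereal (infdist ((cml c A ^^ n) x) D_syn)) = 0 \<and>
        limsup (\<lambda>n. ereal (infdist ((cml c A ^^ n) x) D_syn)) \<ge> ereal \<gamma>\<^sub>0)"
proof -
  let ?m = "CARD('m)"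
  have "(\<lambda>k. growth ?m * (3 ^ ?m * (2/3) ^ k)) \<longlonglongrightarrow> growth ?m * (3 ^ ?m * 0)"
    by (intro tendsto_mult_left LIMSEQ_power_zero) simp
  then have "\<forall>\<^sub>F k in sequentially. growth ?m * shrink ?m k < 1/2"
    by (rule order_tendstoD) simp
  then obtain K where K: "growth ?m * shrink ?m K \<le> 1/2"
    unfolding eventually_sequentially by (meson less_imp_le order_refl)
  define \<epsilon> where "\<epsilon> = scale ?m K"
  have \<epsilon>: "\<epsilon> > 0" by (simp add: \<epsilon>_def)
  have "(\<lambda>n. real ?m * (1/2) ^ n) \<longlonglongrightarrow> real ?m * 0"
    by (intro tendsto_mult_left LIMSEQ_power_zero) simp
  then have "\<forall>\<^sub>F n in sequentially. real ?m * (1/2) ^ n < \<epsilon> / 2"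
    by (rule order_tendstoD) (use \<epsilon> in simp)
  \<comment> \<open>So large that the preimage of the centre given by \<open>reach_centre\<close> is
    within \<open>\<epsilon> / 2\<close> of the prescribed point; the factor \<open>?m\<close>
    converts coordinate bounds into distance.\<close>
  then obtain N where N: "real ?m * (1/2) ^ N < \<epsilon> / 2"
    unfolding eventually_sequentially by (meson order_refl)
  obtain c_plus where cp: "c_plus > 0"
    "\<And>c. \<lbrakk>0 \<le> c; c < c_plus; \<forall>x\<in>unit_cube. coupling c A *v x \<in> unit_cube\<rbrakk> \<Longrightarrow> small_coupling A c (max K N)"
    using small_coupling_exists[of A "max K N"] by blast
  \<comment> \<open>The point \<open>z\<close> chosen in the second half has two coordinates at
    least \<open>8 * \<gamma>\<close> apart. On the ball of radius \<open>\<gamma>\<close> about it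
    they stay more than \<open>6 * \<gamma>\<close> apart, and more than \<open>2 * \<gamma>\<close>
    suffices.\<close>
  define \<gamma> where "\<gamma> = \<epsilon> / 32"
  have \<gamma>: "\<gamma> > 0" using \<epsilon> by (simp add: \<gamma>_def)
  have AE: "AE x in lebesgue. x \<in> unit_cube \<longrightarrow>
        liminf (\<lambda>n. ereal (infdist ((cml c A ^^ n) x) D_syn)) = 0 \<and>
        limsup (\<lambda>n. ereal (infdist ((cml c A ^^ n) x) D_syn)) \<ge> ereal \<gamma>"
    if c: "0 \<le> c" "c < c_plus" "\<forall>x\<in>unit_cube. coupling c A *v x \<in> unit_cube" for c
  proof -
    have sc: "small_coupling A c (max K N)" using cp(2) c by blast
    interpret small_coupling A c K using sc by (rule small_coupling_mono) simp
    interpret N: small_coupling A c N using sc by (rule small_coupling_mono) simp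
    let ?D = "\<lambda>x. infdist x (D_syn :: (real^'m) set)"
    have contD: "continuous_on UNIV ?D" by (intro continuous_intros)
    show ?thesis
    proof (rule AE_liminf_limsup)
      fix r :: real assume r: "r > 0"
      let ?E = "{x \<in> unit_cube. \<forall>n. ?D ((T ^^ n) x) \<in> {r..}}"
      \<comment> \<open>The first bound keeps \<open>ball z \<rho>\<close> inside
        \<open>ball y \<epsilon>\<close>. The second absorbs the stretching by \<open>3 ^ N\<close>,
        so the whole ball is carried to within \<open>r\<close> of the centre, a point of the
        diagonal.\<close>
      define \<rho> where "\<rho> = min (\<epsilon> / 2) (r / 3 ^ N)"
      have \<rho>: "\<rho> > 0" using \<epsilon> r by (simp add: \<rho>_def)
      have cl: "closed ?E" by (intro closed_orbit_condition contD) auto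
      show "negligible ?E"
      proof (rule invariant_negligible[OF K cl _ orbit_condition_invariant vol_ball_pos[OF \<rho>]])
        fix y assume y: "ball y (scale ?m K) \<subseteq> (unit_cube :: (real^'m) set)"
        then have "y \<in> unit_cube" using \<epsilon> by (auto simp: \<epsilon>_def)
        then obtain z where z: "z \<in> unit_cube" "\<And>i. \<bar>z $ i - y $ i\<bar> \<le> 1 / 2 ^ N" "(T ^^ N) z = (\<chi> i. 1/2)"
          using N.reach_centre by blast
        have zy: "dist z y < \<epsilon> / 2"
          using dist_le_of_components[OF z(2)] N unfolding power_one_over by linarith
        have escape: "x \<notin> ?E" if "x \<in> ball z \<rho>" for x
        proof -
          have "(\<chi> i. 1/2) \<in> (D_syn :: (real^'m) set)" by (simp add: D_syn_def unit_cube_def)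
          then have "?D ((T ^^ N) x) \<le> dist ((T ^^ N) x) ((T ^^ N) z)"
            unfolding z(3) by (rule infdist_le)
          also have "\<dots> \<le> 3 ^ N * dist x z" by (rule dist_T_funpow)
          also have "\<dots> < 3 ^ N * (r / 3 ^ N)"
            using that by (intro mult_strict_left_mono) (auto simp: \<rho>_def dist_commute)
          finally have "?D ((T ^^ N) x) < r" by simp
          then show ?thesis by (auto simp: not_le)
        qed
        have sub: "ball z \<rho> \<subseteq> ball y \<epsilon>"
        proof
          fix x assume "x \<in> ball z \<rho>"
          then have "dist z x < \<epsilon> / 2" by (simp add: \<rho>_def)
          then show "x \<in> ball y \<epsilon>" using zy dist_triangle[of y x z] by (simp add: dist_commute)
        qed
        show "vol (ball (0::real^'m) \<rho>) \<le> vol (ball y (scale ?m K) - ?E)"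
          unfolding \<epsilon>_def[symmetric] by (rule vol_ball_diff_ge[OF sub escape cl \<rho>])
      qed auto
    next
      let ?E = "{x \<in> unit_cube. \<forall>n. ?D ((T ^^ n) x) \<in> {..\<gamma>}}"
      have cl: "closed ?E" by (intro closed_orbit_condition contD) auto
      obtain i j :: 'm where ij: "i \<noteq> j"
        using assms(1) by (metis card_2_iff' ex_card UNIV_I)
      show "negligible ?E"
      proof (rule invariant_negligible[OF K cl _ orbit_condition_invariant vol_ball_pos[OF \<gamma>]])
        fix y assume "ball y (scale ?m K) \<subseteq> (unit_cube :: (real^'m) set)"
        \<comment> \<open>The shift changes the difference of the two coordinates by
          \<open>\<epsilon> / 2\<close>, so that difference cannot be below
          \<open>\<epsilon> / 4\<close> in absolute value at both \<open>y\<close> and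
          \<open>y'\<close>.\<close>
        define y' where "y' = y + (\<epsilon> / 2) *\<^sub>R axis i 1"
        have yy': "y' $ i = y $ i + \<epsilon> / 2" "y' $ j = y $ j"
          using ij by (auto simp: y'_def axis_def)
        have dist_y': "dist y y' = \<epsilon> / 2" using \<epsilon> by (simp add: y'_def dist_norm)
        obtain z where z: "dist y z \<le> \<epsilon> / 2" "\<epsilon> / 4 \<le> \<bar>z $ i - z $ j\<bar>"
        proof (cases "\<epsilon> / 4 \<le> \<bar>y $ i - y $ j\<bar>")
          case True
          then show ?thesis using that[of y] \<epsilon> by simp
        next
          case False
          then have "\<epsilon> / 4 \<le> \<bar>y' $ i - y' $ j\<bar>" unfolding yy' by linarith
          then show ?thesis using that[of y'] dist_y' by simp
        qed
        have escape: "x \<notin> ?E" if "x \<in> ball z \<gamma>" for x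
        proof -
          have "\<bar>z $ i - x $ i\<bar> < \<gamma>" "\<bar>z $ j - x $ j\<bar> < \<gamma>"
            using that abs_component_diff_le[of z _ x] by (auto intro: order_le_less_trans)
          then have "2 * \<gamma> < \<bar>x $ i - x $ j\<bar>" using z(2) \<epsilon> unfolding \<gamma>_def by linarith
          then have "\<gamma> < ?D ((T ^^ 0) x)" using D_syn_infdist_ge[of x i j] by simp
          then have "?D ((T ^^ 0) x) \<notin> {..\<gamma>}" by simp
          then show ?thesis by blast
        qed
        have sub: "ball z \<gamma> \<subseteq> ball y \<epsilon>"
        proof
          fix x assume "x \<in> ball z \<gamma>"
          then show "x \<in> ball y \<epsilon>" using z(1) \<epsilon> dist_triangle[of y x z] by (simp add: \<gamma>_def)
        qed
        show "vol (ball (0::real^'m) \<gamma>) \<le> vol (ball y (scale ?m K) - ?E)"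
          unfolding \<epsilon>_def[symmetric] by (rule vol_ball_diff_ge[OF sub escape cl \<gamma>])
      qed auto
    qed
  qed
  show ?thesis
    using cp(1) \<gamma> AE by (intro exI[of _ c_plus] conjI allI impI exI[of _ \<gamma>]) auto
qed

end
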